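(* Let $\alpha\in(0,\frac13)$ and let $R$ be a symmetric random walk on $\mathbb{Z}$ for which there are constants $0<c_0<C_0<\infty$ with $c_0|x|^{-1-\alpha}\le\mathbb{P}_0(R_1=x)\le C_0|x|^{-1-\alpha}$ for all $x\in\mathbb{Z}\setminus\{0\}$. Let $(A_n)_{n\ge1}$ be the DLA process generated by $R$. Then almost surely $\operatorname{Cap}(A_n)=n^{1-o(1)}$ as $n\to\infty$, i.e. $\lim_{n\to\infty}\frac{\log\operatorname{Cap}(A_n)}{\log n}=1$.
   Context: $\mathbb{P}_x$ is the law of the random walk started at $x$, and $p_{x,y}=\mathbb{P}_x(R_1=y)$. For $A\subset\mathbb{Z}$, $T_A=\inf\{n>0:R_n\in A\}$, and $E_A(x)=\mathbb{P}_x(T_A=\infty)$ for every $x\in\mathbb{Z}$ (including $x\in A$). The capacity of a finite set $A$ is $\operatorname{Cap}(A)=\sum_{a\in A}E_A(a)$. The DLA process generated by $R$ is the Markov chain of random finite sets $A_1=\{0\},A_2,A_3,\dots$ with $$\mathbb{P}(A_{n+1}=A\cup\{x\}\mid A_n=A)=\sum_{a\in A}\frac{p_{x,a}E_A(x)}{\operatorname{Cap}(A)},\qquad x\in\mathbb{Z}\setminus A.$$ *)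

theory Defs
  imports "HOL-Probability.Probability"
begin

text \<open>The law \<open>\<P>\<^sub>x\<close>, on path space, of the random walk with step distribution \<open>p\<close> started at \<open>x\<close>.\<close>

definition walk_law :: "int pmf \<Rightarrow> int \<Rightarrow> (nat \<Rightarrow> int) measure" where
  "walk_law p x =
     distr (\<Pi>\<^sub>M i\<in>UNIV. measure_pmf p) (\<Pi>\<^sub>M n\<in>UNIV. count_space UNIV)
       (\<lambda>\<xi> n. x + (\<Sum>i<n. \<xi> i))"

definition symmetric_step :: "int pmf \<Rightarrow> bool" where
  "symmetric_step p \<longleftrightarrow> (\<forall>x. pmf p (- x) = pmf p x)"

definition step_prob :: "int pmf \<Rightarrow> int \<Rightarrow> int \<Rightarrow> real" where
  "step_prob p x y = \<P>(R in walk_law p x. R 1 = y)"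

text \<open>In \<^typ>\<open>enat\<close> the infimum of the empty set is \<open>\<infinity>\<close>; time \<open>0\<close> is excluded.\<close>

definition hitting_time :: "int set \<Rightarrow> (nat \<Rightarrow> int) \<Rightarrow> enat" where
  "hitting_time A R = Inf {enat n |n. n > 0 \<and> R n \<in> A}"

definition escape_prob :: "int pmf \<Rightarrow> int set \<Rightarrow> int \<Rightarrow> real" where
  "escape_prob p A x = \<P>(R in walk_law p x. hitting_time A R = \<infinity>)"

definition capacity :: "int pmf \<Rightarrow> int set \<Rightarrow> real" where
  "capacity p A = (\<Sum>a\<in>A. escape_prob p A a)"

text \<open>
  Chains are indexed from time \<open>1\<close>; the variable \<open>X 0\<close> plays no role. In the Markov property
  the history \<open>B 1, \<dots>, B n\<close> is only required to have positive probability.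
\<close>

definition markov_chain :: "'w measure \<Rightarrow> 's set \<Rightarrow> (nat \<Rightarrow> 'w \<Rightarrow> 's) \<Rightarrow> bool" where
  "markov_chain M S X \<longleftrightarrow>
     prob_space M \<and> countable S \<and> (\<forall>n\<ge>1. X n \<in> M \<rightarrow>\<^sub>M count_space S) \<and>
     (\<forall>n\<ge>1. \<forall>B C. \<P>(\<omega> in M. \<forall>i\<in>{1..n}. X i \<omega> = B i) > 0 \<longrightarrow>
        \<P>(\<omega> in M. X (Suc n) \<omega> = C \<bar> \<forall>i\<in>{1..n}. X i \<omega> = B i) =
        \<P>(\<omega> in M. X (Suc n) \<omega> = C \<bar> X n \<omega> = B n))"

text \<open>
  For symmetric transient walks the prescribed probabilities sum to \<open>1\<close> over \<open>x \<in> - B\<close>,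
  so all other transitions have probability \<open>0\<close>.
\<close>

definition dla_process :: "int pmf \<Rightarrow> 'w measure \<Rightarrow> (nat \<Rightarrow> 'w \<Rightarrow> int set) \<Rightarrow> bool" where
  "dla_process p M A \<longleftrightarrow>
     markov_chain M {B. finite B} A \<and> (AE \<omega> in M. A 1 \<omega> = {0}) \<and>
     (\<forall>n\<ge>1. \<forall>B x. \<P>(\<omega> in M. A n \<omega> = B) > 0 \<longrightarrow> x \<notin> B \<longrightarrow>
        \<P>(\<omega> in M. A (Suc n) \<omega> = B \<union> {x} \<bar> A n \<omega> = B) =
        (\<Sum>a\<in>B. step_prob p x a * escape_prob p B x / capacity p B))"

end

theory Submission
  imports Defs "HOL-Real_Asymp.Real_Asymp"
begin

text \<open>
  Let \<open>Cap (A\<^sub>n) \<le> n powr (1 - \<epsilon>)\<close> for contradiction, so that every unit of escape probability attracts new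
  particles at rate at least \<open>n powr (\<epsilon> - 1)\<close> throughout the time interval \<open>{1..n}\<close>. Call \<open>A\<close> dense around \<open>x\<close>
  from scale \<open>l\<close> on if \<open>A\<close> has at least \<open>c v powr (1/3)\<close> points within distance \<open>v\<close> of \<open>x\<close>, for some \<open>v \<ge> l\<close>.
  One shows inductively, for \<open>l = 1, m, m\<^sup>2, \<dots>\<close> with \<open>m\<close> about \<open>n powr (\<epsilon> / 4)\<close>, that after a delay of smaller
  order than \<open>n\<close> the aggregate is dense from scale \<open>l\<close> on around each of its points. Boundedly many
  steps lead to \<open>l\<close> so large that there would be more than \<open>n\<close> points.

  For the step from \<open>l\<close> to \<open>L = m l\<close>, suppose that \<open>A\<close> is not dense around \<open>x \<in> A\<close> from scale \<open>L\<close> on. The Green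
  function is at most of order \<open>\<bar>z\<bar> powr (- 2/5)\<close>, and \<open>1/3 < 2/5\<close>, so a union bound shows that the
  escape probability is at least \<open>3/4\<close> on average over \<open>{x..<x + L}\<close>. On the other hand, there are at least about
  \<open>l powr (1/3)\<close> points near \<open>x\<close>, and since \<open>\<alpha> < 1/3\<close> this compensates the factor \<open>L powr (- \<alpha>)\<close> for jumps of
  length \<open>L\<close>. So new particles soon occupy half of the cells of length \<open>l\<close> in \<open>{x..<x + L}\<close>. By induction,
  after another delay \<open>A\<close> is dense from scale \<open>l\<close> on around a point of each of these cells, and a Vitali covering
  argument gives density around \<open>x\<close> from scale \<open>L\<close> on.
\<close>

section \<open>Escape probabilities\<close>

text \<open>A finite-horizon \<open>escape_prob\<close>, stated on the step sequences so that the
  first step can be split off. Time 0 is not tested, so the starting point may lie in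
  \<open>A\<close>.\<close>

definition avoid_prob :: "int pmf \<Rightarrow> int set \<Rightarrow> nat \<Rightarrow> int \<Rightarrow> real" where
  "avoid_prob p A n x =
     \<P>(\<xi> in \<Pi>\<^sub>M i\<in>UNIV. measure_pmf p. \<forall>k\<in>{1..n}. x + (\<Sum>i<k. \<xi> i) \<notin> A)"

lemma prob_space_steps: "prob_space (\<Pi>\<^sub>M i\<in>(UNIV :: nat set). measure_pmf p)"
  by (intro prob_space_PiM measure_pmf.prob_space_axioms)

lemma measurable_partial_sum:
  fixes x :: int
  shows "(\<lambda>\<xi>. x + (\<Sum>i<(n::nat). \<xi> i)) \<in> (\<Pi>\<^sub>M i\<in>UNIV. measure_pmf p) \<rightarrow>\<^sub>M count_space UNIV"
proof (induction n)
  case (Suc n)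
  have "(\<lambda>\<xi>. (x + (\<Sum>i<n. \<xi> i), \<xi> n)) \<in>
      (\<Pi>\<^sub>M i\<in>UNIV. measure_pmf p) \<rightarrow>\<^sub>M count_space UNIV \<Otimes>\<^sub>M count_space UNIV"
    using measurable_component_singleton[of n UNIV "\<lambda>_. measure_pmf p"]
    by (intro measurable_Pair Suc) (simp cong: measurable_cong_sets)
  moreover have "(\<lambda>(a, b). a + b :: int) \<in> count_space UNIV \<Otimes>\<^sub>M count_space UNIV \<rightarrow>\<^sub>M count_space UNIV"
    by (simp add: pair_measure_countable)
  ultimately have "(\<lambda>(a, b). a + b) \<circ> (\<lambda>\<xi>. (x + (\<Sum>i<n. \<xi> i), \<xi> n)) \<in>
      (\<Pi>\<^sub>M i\<in>UNIV. measure_pmf p) \<rightarrow>\<^sub>M count_space UNIV"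
    by (rule measurable_comp)
  then show ?case by (simp add: comp_def add.assoc)
qed simp

lemma pred_partial_sum [measurable]:
  fixes x :: int
  shows "Measurable.pred (\<Pi>\<^sub>M i\<in>UNIV. measure_pmf p) (\<lambda>\<xi>. x + (\<Sum>i<(k::nat). \<xi> i) \<notin> A)"
  by (rule measurable_compose[OF measurable_partial_sum]) simp

lemma measurable_walk:
  "(\<lambda>\<xi> n. x + (\<Sum>i<n. \<xi> i)) \<in>
     (\<Pi>\<^sub>M i\<in>UNIV. measure_pmf p) \<rightarrow>\<^sub>M (\<Pi>\<^sub>M n\<in>(UNIV :: nat set). count_space (UNIV :: int set))"
  by (intro measurable_PiM_single' measurable_partial_sum) auto

lemma step_prob_eq_pmf: "step_prob p x y = pmf p (y - x)"
proof -
  let ?S = "\<Pi>\<^sub>M i\<in>(UNIV :: nat set). measure_pmf p"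
  interpret product_prob_space "\<lambda>_. measure_pmf p" "UNIV :: nat set" ..
  have meas: "{R \<in> space (\<Pi>\<^sub>M n\<in>(UNIV :: nat set). count_space (UNIV :: int set)). R 1 = y}
      \<in> sets (\<Pi>\<^sub>M n\<in>UNIV. count_space UNIV)"
    by measurable
  have "step_prob p x y = measure ?S {\<xi> \<in> space ?S. x + \<xi> 0 = y}"
    unfolding step_prob_def walk_law_def space_distr
    by (subst measure_distr[OF measurable_walk meas], rule arg_cong[where f = "measure _"])
       (auto simp: space_PiM)
  also have "{\<xi> \<in> space ?S. x + \<xi> 0 = y} = {\<xi> \<in> space ?S. \<xi> 0 \<in> {y - x}}"
    by auto
  also have "measure ?S \<dots> = measure (measure_pmf p) {y - x}"
    using emeasure_PiM_Collect_single[of 0 "{y - x}"]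
    by (simp add: measure_def)
  finally show ?thesis by (simp add: pmf.rep_eq)
qed

lemma escape_prob_eq:
  "escape_prob p A x = \<P>(\<xi> in \<Pi>\<^sub>M i\<in>(UNIV :: nat set). measure_pmf p. \<forall>n\<ge>1. x + (\<Sum>i<n. \<xi> i) \<notin> A)"
proof -
  have *: "hitting_time A R = \<infinity> \<longleftrightarrow> (\<forall>n\<ge>1. R n \<notin> A)" for R
  proof -
    have "hitting_time A R = \<infinity> \<longleftrightarrow> {enat n |n. n > 0 \<and> R n \<in> A} = {}"
    proof
      assume "hitting_time A R = \<infinity>"
      moreover have "hitting_time A R \<le> enat n" if "n > 0" "R n \<in> A" for n
        unfolding hitting_time_def using that by (intro Inf_lower) auto
      ultimately show "{enat n |n. n > 0 \<and> R n \<in> A} = {}" by auto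
    next
      assume *: "{enat n |n. n > 0 \<and> R n \<in> A} = {}"
      show "hitting_time A R = \<infinity>"
        unfolding hitting_time_def * by (simp add: top_enat_def)
    qed
    also have "\<dots> \<longleftrightarrow> (\<forall>n\<ge>1. R n \<notin> A)"
      by (simp add: Suc_le_eq) (metis neq0_conv)
    finally show ?thesis .
  qed
  have meas: "{R \<in> space (\<Pi>\<^sub>M n\<in>(UNIV :: nat set). count_space (UNIV :: int set)). \<forall>n\<ge>1. R n \<notin> A}
      \<in> sets (\<Pi>\<^sub>M n\<in>UNIV. count_space UNIV)"
    by measurable
  show ?thesis
    unfolding escape_prob_def walk_law_def space_distr *
    by (subst measure_distr[OF measurable_walk meas], rule arg_cong[where f = "measure _"])
       (auto simp: space_PiM)
qed

lemma avoid_prob_bounds: "0 \<le> avoid_prob p A n x" "avoid_prob p A n x \<le> 1"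
proof -
  interpret prob_space "\<Pi>\<^sub>M i\<in>(UNIV :: nat set). measure_pmf p" by (rule prob_space_steps)
  show "0 \<le> avoid_prob p A n x" "avoid_prob p A n x \<le> 1"
    by (simp_all add: avoid_prob_def)
qed

lemma avoid_prob_0: "avoid_prob p A 0 x = 1"
proof -
  interpret prob_space "\<Pi>\<^sub>M i\<in>(UNIV :: nat set). measure_pmf p" by (rule prob_space_steps)
  show ?thesis by (simp add: avoid_prob_def prob_space)
qed

lemma avoid_prob_tendsto: "(\<lambda>n. avoid_prob p A n x) \<longlonglongrightarrow> escape_prob p A x"
proof -
  let ?S = "\<Pi>\<^sub>M i\<in>(UNIV :: nat set). measure_pmf p"
  interpret prob_space ?S by (rule prob_space_steps)
  let ?B = "\<lambda>n. {\<xi> \<in> space ?S. \<forall>k\<in>{1..n}. x + (\<Sum>i<k. \<xi> i) \<notin> A}"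
  have "(\<lambda>n. measure ?S (?B n)) \<longlonglongrightarrow> measure ?S (\<Inter>n. ?B n)"
    by (intro finite_Lim_measure_decseq) (auto simp: decseq_def)
  moreover have "(\<Inter>n. ?B n) = {\<xi> \<in> space ?S. \<forall>n\<ge>1. x + (\<Sum>i<n. \<xi> i) \<notin> A}" by force
  ultimately show ?thesis unfolding avoid_prob_def escape_prob_eq by simp
qed

lemma avoid_prob_antimono: "m \<le> n \<Longrightarrow> avoid_prob p A n x \<le> avoid_prob p A m x"
proof -
  assume "m \<le> n"
  interpret prob_space "\<Pi>\<^sub>M i\<in>(UNIV :: nat set). measure_pmf p" by (rule prob_space_steps)
  show ?thesis
    unfolding avoid_prob_def using \<open>m \<le> n\<close> by (intro finite_measure_mono) auto
qed

text \<open>First-step analysis: a fresh step put in front of an independent copy of the step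
  sequence has the law of the sequence itself. Since \<open>avoid_prob\<close> ignores time 0, the
  indicator tests where the first step lands.\<close>

lemma avoid_prob_Suc:
  "avoid_prob p A (Suc n) x =
     (\<integral>s. indicator (- A) (x + s) * avoid_prob p A n (x + s) \<partial>measure_pmf p)"
proof -
  let ?S = "\<Pi>\<^sub>M i\<in>(UNIV :: nat set). measure_pmf p"
  interpret S: sequence_space "measure_pmf p" ..
  interpret prob_space ?S by (rule prob_space_steps)
  define X where "X = (\<lambda>n x. {\<xi> \<in> space ?S. \<forall>k\<in>{1..n}. x + (\<Sum>i<k. \<xi> i) \<notin> A})"
  have X [measurable]: "X n x \<in> sets ?S" for n x unfolding X_def by measurable
  have split: "case_nat s \<xi> \<in> X (Suc n) x \<longleftrightarrow> x + s \<notin> A \<and> \<xi> \<in> X n (x + s)" for s \<xi>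
  proof -
    have *: "{1..Suc n} = Suc ` {0..n}" by simp
    have "(\<forall>k\<in>{1..Suc n}. x + (\<Sum>i<k. case_nat s \<xi> i) \<notin> A) \<longleftrightarrow>
        (\<forall>k\<in>{0..n}. x + (\<Sum>i<Suc k. case_nat s \<xi> i) \<notin> A)"
      unfolding * by blast
    also have "\<dots> \<longleftrightarrow> (\<forall>k\<in>{0..n}. (x + s) + (\<Sum>i<k. \<xi> i) \<notin> A)"
      by (simp only: sum.lessThan_Suc_shift) (simp add: add.assoc)
    also have "\<dots> \<longleftrightarrow> x + s \<notin> A \<and> (\<forall>k\<in>{1..n}. (x + s) + (\<Sum>i<k. \<xi> i) \<notin> A)"
      by (auto simp: Ball_def) (metis Suc_le_eq bot_nat_0.not_eq_extremum lessThan_0 sum.empty add.right_neutral One_nat_def)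
    finally show ?thesis by (auto simp: X_def space_PiM)
  qed
  have "emeasure ?S (X (Suc n) x) =
      emeasure (distr (measure_pmf p \<Otimes>\<^sub>M ?S) ?S (\<lambda>(s, \<omega>). case_nat s \<omega>)) (X (Suc n) x)"
    by (simp add: S.PiM_iter)
  also have "\<dots> = (\<integral>\<^sup>+ z. indicator (X (Suc n) x) (case z of (s, \<omega>) \<Rightarrow> case_nat s \<omega>) \<partial>(measure_pmf p \<Otimes>\<^sub>M ?S))"
    by (subst nn_integral_indicator[symmetric], simp) (rule nn_integral_distr, simp_all)
  also have "\<dots> = (\<integral>\<^sup>+ s. \<integral>\<^sup>+ \<omega>. indicator (X (Suc n) x) (case_nat s \<omega>) \<partial>?S \<partial>measure_pmf p)"
    by (subst S.P.nn_integral_fst[symmetric]) simp_all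
  also have "\<dots> = (\<integral>\<^sup>+ s. \<integral>\<^sup>+ \<omega>. indicator (- A) (x + s) * indicator (X n (x + s)) \<omega> \<partial>?S \<partial>measure_pmf p)"
    by (intro nn_integral_cong) (auto simp: split indicator_def)
  also have "\<dots> = (\<integral>\<^sup>+ s. ennreal (indicator (- A) (x + s) * measure ?S (X n (x + s))) \<partial>measure_pmf p)"
    by (intro nn_integral_cong)
       (simp add: nn_integral_cmult S.emeasure_eq_measure ennreal_mult' ennreal_indicator)
  also have "\<dots> = ennreal (\<integral>s. indicator (- A) (x + s) * measure ?S (X n (x + s)) \<partial>measure_pmf p)"
    by (intro nn_integral_eq_integral measure_pmf.integrable_const_bound[where B = 1])
       (auto simp: indicator_def)
  finally have "measure ?S (X (Suc n) x) =
      (\<integral>s. indicator (- A) (x + s) * measure ?S (X n (x + s)) \<partial>measure_pmf p)"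
    unfolding S.emeasure_eq_measure by (subst (asm) ennreal_inj) (auto intro!: integral_nonneg_AE)
  then show ?thesis unfolding avoid_prob_def X_def .
qed

lemma integrable_measure_pmf_bounded:
  fixes f :: "'a \<Rightarrow> real"
  assumes "\<And>x. \<bar>f x\<bar> \<le> B"
  shows "integrable (measure_pmf p) f"
  by (rule measure_pmf.integrable_const_bound[where B = B]) (auto simp: assms)

lemma escape_prob_bounds: "0 \<le> escape_prob p A x" "escape_prob p A x \<le> 1"
proof -
  show "0 \<le> escape_prob p A x"
    by (rule LIMSEQ_le_const[OF avoid_prob_tendsto]) (auto simp: avoid_prob_bounds)
  show "escape_prob p A x \<le> 1"
    by (rule LIMSEQ_le_const2[OF avoid_prob_tendsto]) (auto simp: avoid_prob_bounds)
qed

lemma escape_prob_le_avoid_prob: "escape_prob p A x \<le> avoid_prob p A n x"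
  by (rule LIMSEQ_le_const2[OF avoid_prob_tendsto]) (auto intro: avoid_prob_antimono)

lemma escape_prob_first_step:
  "escape_prob p A x = (\<integral>s. indicator (- A) (x + s) * escape_prob p A (x + s) \<partial>measure_pmf p)"
proof -
  have "(\<lambda>n. \<integral>s. indicator (- A) (x + s) * avoid_prob p A n (x + s) \<partial>measure_pmf p) \<longlonglongrightarrow>
      (\<integral>s. indicator (- A) (x + s) * escape_prob p A (x + s) \<partial>measure_pmf p)"
    by (rule integral_dominated_convergence[where w = "\<lambda>_. 1"])
       (auto intro!: tendsto_mult avoid_prob_tendsto simp: avoid_prob_bounds indicator_def)
  moreover have "(\<lambda>n. avoid_prob p A (Suc n) x) \<longlonglongrightarrow> escape_prob p A x"
    by (rule LIMSEQ_Suc[OF avoid_prob_tendsto])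
  ultimately show ?thesis
    unfolding avoid_prob_Suc by (rule LIMSEQ_unique[rotated])
qed

lemma avoid_prob_mono:
  assumes "A \<subseteq> B"
  shows "avoid_prob p B n x \<le> avoid_prob p A n x"
proof -
  interpret prob_space "\<Pi>\<^sub>M i\<in>(UNIV :: nat set). measure_pmf p" by (rule prob_space_steps)
  show ?thesis
    unfolding avoid_prob_def using assms by (intro finite_measure_mono) auto
qed

section \<open>Monotonicity of the capacity\<close>

text \<open>In contrast to \<open>avoid_prob\<close>, time 0 counts here. This makes the function
  monotone in \<open>A\<close>, and averaging it over one step gives \<open>1 - avoid_prob\<close>
  at the next horizon.\<close>

definition visit_prob :: "int pmf \<Rightarrow> int set \<Rightarrow> nat \<Rightarrow> int \<Rightarrow> real" where
  "visit_prob p A n x = (if x \<in> A then 1 else 1 - avoid_prob p A n x)"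

lemma visit_prob_bounds: "0 \<le> visit_prob p A n x" "visit_prob p A n x \<le> 1"
  by (auto simp: visit_prob_def avoid_prob_bounds)

lemma one_minus_avoid_prob_Suc:
  "1 - avoid_prob p A (Suc n) x = (\<integral>s. visit_prob p A n (x + s) \<partial>measure_pmf p)"
proof -
  have "1 - avoid_prob p A (Suc n) x =
      (\<integral>s. 1 \<partial>measure_pmf p) - (\<integral>s. indicator (- A) (x + s) * avoid_prob p A n (x + s) \<partial>measure_pmf p)"
    by (simp add: avoid_prob_Suc)
  also have "\<dots> = (\<integral>s. 1 - indicator (- A) (x + s) * avoid_prob p A n (x + s) \<partial>measure_pmf p)"
    by (rule Bochner_Integration.integral_diff[symmetric])
       (auto intro!: integrable_measure_pmf_bounded[where B = 1] simp: avoid_prob_bounds indicator_def)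
  also have "\<dots> = (\<integral>s. visit_prob p A n (x + s) \<partial>measure_pmf p)"
    by (rule Bochner_Integration.integral_cong) (auto simp: visit_prob_def indicator_def)
  finally show ?thesis .
qed

text \<open>Counting measure is invariant under the walk: by Tonelli the shifted sums can be taken
  first, and the weights \<open>pmf p s\<close> have total mass 1.\<close>

lemma nn_integral_count_space_convolution:
  fixes f :: "int \<Rightarrow> ennreal"
  shows "(\<integral>\<^sup>+ x. (\<integral>\<^sup>+ s. f (x + s) \<partial>measure_pmf p) \<partial>count_space UNIV) = (\<integral>\<^sup>+ x. f x \<partial>count_space UNIV)"
proof -
  have "(\<integral>\<^sup>+ x. (\<integral>\<^sup>+ s. f (x + s) \<partial>measure_pmf p) \<partial>count_space UNIV) =
      (\<integral>\<^sup>+ x. (\<integral>\<^sup>+ s. (\<lambda>(x, s). pmf p s * f (x + s)) (x, s) \<partial>count_space UNIV) \<partial>count_space UNIV)"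
    by (simp add: nn_integral_measure_pmf)
  also have "\<dots> = (\<integral>\<^sup>+ s. (\<integral>\<^sup>+ x. (\<lambda>(x, s). pmf p s * f (x + s)) (x, s) \<partial>count_space UNIV) \<partial>count_space UNIV)"
    unfolding nn_integral_fst_count_space nn_integral_snd_count_space ..
  also have "\<dots> = (\<integral>\<^sup>+ s. pmf p s * (\<integral>\<^sup>+ x. f (x + s) \<partial>count_space UNIV) \<partial>count_space UNIV)"
    by (simp add: nn_integral_cmult)
  also have "\<dots> = (\<integral>\<^sup>+ s. pmf p s * (\<integral>\<^sup>+ x. f x \<partial>count_space UNIV) \<partial>count_space UNIV)"
  proof -
    have "(\<integral>\<^sup>+ x. f (x + s) \<partial>count_space UNIV) = (\<integral>\<^sup>+ x. f x \<partial>count_space UNIV)" for s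
      by (rule nn_integral_bij_count_space) (rule bij_betw_byWitness[where f' = "\<lambda>x. x - s"], auto)
    then show ?thesis by simp
  qed
  also have "\<dots> = (\<integral>\<^sup>+ s. pmf p s \<partial>count_space UNIV) * (\<integral>\<^sup>+ x. f x \<partial>count_space UNIV)"
    by (simp add: nn_integral_multc)
  also have "\<dots> = (\<integral>\<^sup>+ x. f x \<partial>count_space UNIV)"
    by (simp add: nn_integral_pmf)
  finally show ?thesis .
qed

text \<open>
  The left-hand side is monotone in \<open>A\<close>; the right-hand side, divided by \<open>n\<close>, tends to the capacity
  of \<open>A\<close>.
\<close>

lemma nn_integral_visit_prob:
  assumes "finite A"
  shows "(\<integral>\<^sup>+ x. visit_prob p A n x \<partial>count_space UNIV) =
    ennreal (\<Sum>k\<le>n. \<Sum>a\<in>A. avoid_prob p A k a)"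
proof (induction n)
  case 0
  have "(\<integral>\<^sup>+ x. visit_prob p A 0 x \<partial>count_space UNIV) = (\<integral>\<^sup>+ x. indicator A x \<partial>count_space UNIV)"
    by (rule nn_integral_cong) (auto simp: visit_prob_def avoid_prob_0)
  then show ?case
    using assms by (simp add: avoid_prob_0 ennreal_of_nat_eq_real_of_nat)
next
  case (Suc n)
  let ?v = "\<lambda>a. avoid_prob p A (Suc n) a"
  have bd: "0 \<le> 1 - ?v a" for a using avoid_prob_bounds[of p A "Suc n" a] by simp
  \<comment> \<open>Adding \<open>1 - ?v\<close> on \<open>A\<close> turns the integrand into
    \<open>indicator A x + (1 - ?v x)\<close> everywhere. The added term is finite and is cancelled
    at the end, which avoids subtraction in \<open>ennreal\<close>.\<close>
  have "(\<integral>\<^sup>+ x. ennreal (visit_prob p A (Suc n) x) \<partial>count_space UNIV) +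
        (\<integral>\<^sup>+ x. ennreal (indicator A x * (1 - ?v x)) \<partial>count_space UNIV) =
      (\<integral>\<^sup>+ x. ennreal (visit_prob p A (Suc n) x) + ennreal (indicator A x * (1 - ?v x)) \<partial>count_space UNIV)"
    by (simp add: nn_integral_add)
  also have "\<dots> = (\<integral>\<^sup>+ x. indicator A x + ennreal (1 - ?v x) \<partial>count_space UNIV)"
    using bd by (intro nn_integral_cong) (auto simp: visit_prob_def indicator_def)
  also have "\<dots> = (\<integral>\<^sup>+ x. indicator A x \<partial>count_space UNIV) + (\<integral>\<^sup>+ x. ennreal (1 - ?v x) \<partial>count_space UNIV)"
    by (simp add: nn_integral_add)
  also have "(\<integral>\<^sup>+ x. ennreal (1 - ?v x) \<partial>count_space UNIV) =
      (\<integral>\<^sup>+ x. (\<integral>\<^sup>+ s. visit_prob p A n (x + s) \<partial>measure_pmf p) \<partial>count_space UNIV)"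
    unfolding one_minus_avoid_prob_Suc
    by (intro nn_integral_cong nn_integral_eq_integral[symmetric] integrable_measure_pmf_bounded[where B = 1])
       (auto simp: visit_prob_bounds)
  also have "\<dots> = ennreal (\<Sum>k\<le>n. \<Sum>a\<in>A. avoid_prob p A k a)"
    using nn_integral_count_space_convolution[where f = "\<lambda>x. ennreal (visit_prob p A n x)" and p = p] by (simp add: Suc)
  also have "(\<integral>\<^sup>+ x. indicator A x \<partial>count_space UNIV) = ennreal (\<Sum>a\<in>A. 1)"
    using assms by (simp add: ennreal_of_nat_eq_real_of_nat)
  also have "(\<integral>\<^sup>+ x. ennreal (indicator A x * (1 - ?v x)) \<partial>count_space UNIV) = ennreal (\<Sum>a\<in>A. 1 - ?v a)"
  proof -
    have "(\<integral>\<^sup>+ x. ennreal (indicator A x * (1 - ?v x)) \<partial>count_space UNIV) =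
        (\<integral>\<^sup>+ x. ennreal (1 - ?v x) * indicator A x \<partial>count_space UNIV)"
      by (intro nn_integral_cong) (auto simp: indicator_def)
    also have "\<dots> = (\<Sum>a\<in>A. ennreal (1 - ?v a))"
      using assms by (simp add: nn_integral_count_space_indicator[symmetric] nn_integral_count_space_finite)
    also have "\<dots> = ennreal (\<Sum>a\<in>A. 1 - ?v a)"
      using bd by (intro sum_ennreal) auto
    finally show ?thesis .
  qed
  also have "ennreal (\<Sum>a\<in>A. 1) + ennreal (\<Sum>k\<le>n. \<Sum>a\<in>A. avoid_prob p A k a) =
      ennreal (\<Sum>k\<le>Suc n. \<Sum>a\<in>A. avoid_prob p A k a) + ennreal (\<Sum>a\<in>A. 1 - ?v a)"
  proof -
    have "0 \<le> (\<Sum>k\<le>n. \<Sum>a\<in>A. avoid_prob p A k a)" "0 \<le> (\<Sum>k\<le>Suc n. \<Sum>a\<in>A. avoid_prob p A k a)"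
         "0 \<le> (\<Sum>a\<in>A. 1 - ?v a)"
      by (auto intro!: sum_nonneg add_nonneg_nonneg bd avoid_prob_bounds simp del: sum_subtractf)
    then show ?thesis
      by (simp add: ennreal_plus[symmetric] sum_subtractf add.commute del: ennreal_plus)
  qed
  finally show ?case
    by (simp add: ennreal_add_left_cancel add.commute[of _ "ennreal (\<Sum>a\<in>A. 1 - ?v a)"])
qed

text \<open>If \<open>b\<close> were smaller than \<open>a\<close>, late terms of \<open>g\<close>
  would lie below \<open>a\<close> by a fixed amount, and the accumulated loss would exceed any
  initial advantage of \<open>g\<close>. This compares limits when only partial sums are
  comparable.\<close>

lemma cesaro_mono:
  fixes f g :: "nat \<Rightarrow> real"
  assumes f: "f \<longlonglongrightarrow> a" and g: "g \<longlonglongrightarrow> b" and "\<And>n. a \<le> f n"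
    and le: "\<And>n. (\<Sum>k\<le>n. f k) \<le> (\<Sum>k\<le>n. g k)"
  shows "a \<le> b"
proof (rule ccontr)
  assume "\<not> a \<le> b"
  define d where "d = (a - b) / 2"
  have "d > 0" using \<open>\<not> a \<le> b\<close> by (simp add: d_def)
  have "b < a - d" using \<open>\<not> a \<le> b\<close> by (simp add: d_def field_simps)
  then have "eventually (\<lambda>n. g n < a - d) sequentially"
    using g by (auto intro: order_tendstoD)
  then obtain N where N: "\<And>n. n \<ge> N \<Longrightarrow> g n < a - d"
    by (auto simp: eventually_sequentially)
  \<comment> \<open>\<open>m\<close> late terms, each losing \<open>d\<close>, outweigh the surplus
    of the first \<open>N\<close> terms of \<open>g\<close> over \<open>a\<close>.\<close>
  obtain m :: nat where m: "(\<Sum>k<N. g k) - real N * a < real m * d"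
    using reals_Archimedean3[OF \<open>d > 0\<close>] by blast
  have "real (N + m + 1) * a \<le> (\<Sum>k\<le>N + m. f k)"
    using sum_bounded_below[of "{..N + m}" a f] assms(3) by simp
  also have "\<dots> \<le> (\<Sum>k\<le>N + m. g k)" by (rule le)
  also have "{..N + m} = {..<N} \<union> {N..N + m}" by auto
  also have "(\<Sum>k\<in>\<dots>. g k) = (\<Sum>k<N. g k) + (\<Sum>k\<in>{N..N + m}. g k)"
    by (rule sum.union_disjoint) auto
  also have "(\<Sum>k\<in>{N..N + m}. g k) \<le> real (m + 1) * (a - d)"
    using sum_bounded_above[of "{N..N + m}" g "a - d"] N by (auto intro: less_imp_le)
  finally show False using m \<open>d > 0\<close> by (simp add: algebra_simps)
qed

text \<open>Enlarging the set lowers each single escape probability, so there is no termwise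
  comparison. Instead the sums of \<open>visit_prob\<close> over all starting points are compared;
  their increments in \<open>n\<close> converge to the capacities.\<close>

lemma capacity_mono:
  assumes "finite B" "A \<subseteq> B"
  shows "capacity p A \<le> capacity p B"
proof (rule cesaro_mono)
  have "finite A" using assms finite_subset by blast
  show "(\<lambda>n. \<Sum>a\<in>A. avoid_prob p A n a) \<longlonglongrightarrow> capacity p A"
       "(\<lambda>n. \<Sum>a\<in>B. avoid_prob p B n a) \<longlonglongrightarrow> capacity p B"
    unfolding capacity_def by (auto intro!: tendsto_sum avoid_prob_tendsto)
  show "capacity p A \<le> (\<Sum>a\<in>A. avoid_prob p A n a)" for n
    unfolding capacity_def by (intro sum_mono escape_prob_le_avoid_prob)
  have "(\<integral>\<^sup>+ x. visit_prob p A n x \<partial>count_space UNIV) \<le> (\<integral>\<^sup>+ x. visit_prob p B n x \<partial>count_space UNIV)" for n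
    using assms(2) avoid_prob_mono[OF assms(2)] avoid_prob_bounds
    by (intro nn_integral_mono ennreal_leI) (auto simp: visit_prob_def)
  then show "(\<Sum>k\<le>n. \<Sum>a\<in>A. avoid_prob p A k a) \<le> (\<Sum>k\<le>n. \<Sum>a\<in>B. avoid_prob p B k a)" for n
    unfolding nn_integral_visit_prob[OF \<open>finite A\<close>] nn_integral_visit_prob[OF assms(1)]
    by (subst (asm) ennreal_le_iff) (auto intro!: sum_nonneg avoid_prob_bounds)
qed

lemma capacity_nonneg: "0 \<le> capacity p A"
  unfolding capacity_def by (intro sum_nonneg escape_prob_bounds)

lemma capacity_le_card: "capacity p A \<le> card A"
  unfolding capacity_def using sum_bounded_above[of A "escape_prob p A" 1] escape_prob_bounds by simp

text \<open>By symmetry a jump from \<open>x\<close> to \<open>a\<close> is as likely as one from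
  \<open>a\<close> to \<open>x\<close>, so for fixed \<open>a\<close> the sum over \<open>x\<close>
  is the first-step decomposition of \<open>escape_prob p B a\<close>. Hence the prescribed
  transition probabilities have total mass 1 once the capacity is positive.\<close>

lemma nn_integral_attachment:
  assumes sym: "symmetric_step p" and fin: "finite B"
  shows "(\<integral>\<^sup>+ x. ennreal (indicator (- B) x * (\<Sum>a\<in>B. step_prob p x a * escape_prob p B x)) \<partial>count_space UNIV)
    = ennreal (capacity p B)"
proof -
  have "(\<integral>\<^sup>+ x. ennreal (indicator (- B) x * (\<Sum>a\<in>B. step_prob p x a * escape_prob p B x)) \<partial>count_space UNIV)
      = (\<integral>\<^sup>+ x. (\<Sum>a\<in>B. ennreal (pmf p (x - a)) * ennreal (indicator (- B) x * escape_prob p B x)) \<partial>count_space UNIV)"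
  proof (intro nn_integral_cong)
    fix x
    have "pmf p (a - x) = pmf p (x - a)" for a
      using sym unfolding symmetric_step_def by (metis minus_diff_eq)
    then have "indicator (- B) x * (\<Sum>a\<in>B. step_prob p x a * escape_prob p B x) =
        (\<Sum>a\<in>B. pmf p (x - a) * (indicator (- B) x * escape_prob p B x))"
      by (simp add: step_prob_eq_pmf sum_distrib_left mult_ac)
    then show "ennreal (indicator (- B) x * (\<Sum>a\<in>B. step_prob p x a * escape_prob p B x)) =
        (\<Sum>a\<in>B. ennreal (pmf p (x - a)) * ennreal (indicator (- B) x * escape_prob p B x))"
      by (simp add: escape_prob_bounds ennreal_mult'[symmetric])
  qed
  also have "\<dots> = (\<Sum>a\<in>B. \<integral>\<^sup>+ x. ennreal (pmf p (x - a)) * ennreal (indicator (- B) x * escape_prob p B x) \<partial>count_space UNIV)"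
    by (rule nn_integral_sum) simp
  also have "\<dots> = (\<Sum>a\<in>B. ennreal (escape_prob p B a))"
  proof (rule sum.cong[OF refl])
    fix a
    have "(\<integral>\<^sup>+ x. ennreal (pmf p (x - a)) * ennreal (indicator (- B) x * escape_prob p B x) \<partial>count_space UNIV)
       = (\<integral>\<^sup>+ s. ennreal (pmf p ((a + s) - a)) * ennreal (indicator (- B) (a + s) * escape_prob p B (a + s)) \<partial>count_space UNIV)"
      by (rule nn_integral_bij_count_space[symmetric, where g = "\<lambda>s. a + s"])
         (rule bij_betw_byWitness[where f' = "\<lambda>x. x - a"], auto)
    also have "\<dots> = (\<integral>\<^sup>+ s. ennreal (indicator (- B) (a + s) * escape_prob p B (a + s)) \<partial>measure_pmf p)"
      by (simp add: nn_integral_measure_pmf)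
    also have "\<dots> = ennreal (\<integral>s. indicator (- B) (a + s) * escape_prob p B (a + s) \<partial>measure_pmf p)"
      by (intro nn_integral_eq_integral integrable_measure_pmf_bounded[where B = 1])
         (auto simp: escape_prob_bounds indicator_def)
    finally show "(\<integral>\<^sup>+ x. ennreal (pmf p (x - a)) * ennreal (indicator (- B) x * escape_prob p B x) \<partial>count_space UNIV)
        = ennreal (escape_prob p B a)"
      by (simp add: escape_prob_first_step[symmetric])
  qed
  also have "\<dots> = ennreal (capacity p B)"
    unfolding capacity_def by (rule sum_ennreal) (simp add: escape_prob_bounds)
  finally show ?thesis .
qed

section \<open>Green function bounds\<close>

text \<open>The law of the displacement after \<open>n\<close> steps. The first step is the one
  split off, to match \<open>avoid_prob_Suc\<close>.\<close>

fun walk_pmf :: "int pmf \<Rightarrow> nat \<Rightarrow> int pmf" where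
  "walk_pmf p 0 = return_pmf 0"
| "walk_pmf p (Suc n) = bind_pmf p (\<lambda>s. map_pmf ((+) s) (walk_pmf p n))"

lemma pmf_walk_pmf_Suc:
  "pmf (walk_pmf p (Suc n)) z = (\<integral>s. pmf (walk_pmf p n) (z - s) \<partial>measure_pmf p)"
proof -
  have "pmf (map_pmf ((+) s) (walk_pmf p n)) z = pmf (walk_pmf p n) (z - s)" for s
    using pmf_map_inj'[of "(+) s" "walk_pmf p n" "z - s"] by (simp add: inj_def)
  then show ?thesis by (simp add: pmf_bind)
qed

text \<open>A union bound over times and sites, by induction along the first-step recursion. The
  term for \<open>k = 0\<close> inside the proof accounts for a first step that lands in
  \<open>A\<close>.\<close>

lemma one_minus_avoid_prob_le:
  assumes "finite A"
  shows "1 - avoid_prob p A n x \<le> (\<Sum>k=1..n. \<Sum>b\<in>A. pmf (walk_pmf p k) (b - x))"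
proof (induction n arbitrary: x)
  case (Suc n)
  have "visit_prob p A n y \<le> (\<Sum>k\<in>{0..n}. \<Sum>b\<in>A. pmf (walk_pmf p k) (b - y))" for y
  proof (cases "y \<in> A")
    case True
    have "1 = pmf (walk_pmf p 0) (y - y)" by simp
    also have "\<dots> \<le> (\<Sum>b\<in>A. pmf (walk_pmf p 0) (b - y))"
      using True assms by (intro member_le_sum) auto
    also have "\<dots> \<le> (\<Sum>k\<in>{0..n}. \<Sum>b\<in>A. pmf (walk_pmf p k) (b - y))"
      by (intro member_le_sum[of 0 "{0..n}" "\<lambda>k. \<Sum>b\<in>A. pmf (walk_pmf p k) (b - y)"])
         (auto intro: sum_nonneg)
    finally show ?thesis using True by (simp add: visit_prob_def)
  next
    case False
    have "(\<Sum>k\<in>{1..n}. \<Sum>b\<in>A. pmf (walk_pmf p k) (b - y)) \<le>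
        (\<Sum>k\<in>{0..n}. \<Sum>b\<in>A. pmf (walk_pmf p k) (b - y))"
      by (intro sum_mono2) (auto intro: sum_nonneg)
    then show ?thesis using Suc[of y] False by (simp add: visit_prob_def)
  qed
  moreover have int: "integrable (measure_pmf p) (\<lambda>s. pmf (walk_pmf p k) (b - (x + s)))" for k b
    by (intro integrable_measure_pmf_bounded[where B = 1]) (auto simp: pmf_le_1)
  ultimately have "(\<integral>s. visit_prob p A n (x + s) \<partial>measure_pmf p) \<le>
      (\<integral>s. (\<Sum>k\<in>{0..n}. \<Sum>b\<in>A. pmf (walk_pmf p k) (b - (x + s))) \<partial>measure_pmf p)"
    by (intro integral_mono Bochner_Integration.integrable_sum int integrable_measure_pmf_bounded[where B = 1])
       (auto simp: visit_prob_bounds)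
  also have "\<dots> = (\<Sum>k\<in>{0..n}. \<Sum>b\<in>A. (\<integral>s. pmf (walk_pmf p k) (b - (x + s)) \<partial>measure_pmf p))"
    by (simp add: int)
  also have "\<dots> = (\<Sum>k\<in>{0..n}. \<Sum>b\<in>A. pmf (walk_pmf p (Suc k)) (b - x))"
    by (simp only: pmf_walk_pmf_Suc diff_diff_eq)
  also have "\<dots> = (\<Sum>k\<in>{1..Suc n}. \<Sum>b\<in>A. pmf (walk_pmf p k) (b - x))"
    by (rule sum.reindex_bij_witness[of _ "\<lambda>k. k - 1" Suc]) auto
  finally show ?case by (simp only: one_minus_avoid_prob_Suc)
qed (simp add: avoid_prob_0)

text \<open>For steps in \<open>S\<close> the smallness of \<open>p\<close> is combined with the
  total mass 1 of \<open>q\<close>; for all other steps the bound on \<open>q\<close> is used and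
  the probability of such a step is kept.\<close>

lemma pmf_convolution_le:
  fixes z :: int
  assumes S: "\<And>s. s \<in> S \<Longrightarrow> pmf p s \<le> b" and "0 \<le> b"
    and M: "\<And>s. s \<notin> S \<Longrightarrow> pmf q (z - s) \<le> M" and "0 \<le> M"
  shows "(\<integral>s. pmf q (z - s) \<partial>measure_pmf p) \<le> b + M * measure (measure_pmf p) (- S)"
proof -
  have "(\<integral>\<^sup>+ s. ennreal (indicator S s * pmf q (z - s)) \<partial>measure_pmf p) =
      (\<integral>\<^sup>+ s. ennreal (pmf p s) * ennreal (indicator S s * pmf q (z - s)) \<partial>count_space UNIV)"
    by (simp add: nn_integral_measure_pmf)
  also have "\<dots> \<le> (\<integral>\<^sup>+ s. ennreal b * pmf q (z - s) \<partial>count_space UNIV)"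
    by (intro nn_integral_mono) (auto simp: indicator_def S intro!: mult_right_mono ennreal_leI)
  also have "\<dots> = ennreal b * (\<integral>\<^sup>+ s. pmf q (z - s) \<partial>count_space UNIV)"
    by (simp add: nn_integral_cmult)
  also have "(\<integral>\<^sup>+ s. pmf q (z - s) \<partial>count_space UNIV) = (\<integral>\<^sup>+ s. pmf q s \<partial>count_space UNIV)"
    by (rule nn_integral_bij_count_space) (rule bij_betw_byWitness[where f' = "\<lambda>s. z - s"], auto)
  also have "\<dots> = 1" by (simp add: nn_integral_pmf)
  finally have on_S: "(\<integral>\<^sup>+ s. ennreal (indicator S s * pmf q (z - s)) \<partial>measure_pmf p) \<le> ennreal b"
    by simp
  have "ennreal (\<integral>s. pmf q (z - s) \<partial>measure_pmf p) = (\<integral>\<^sup>+ s. pmf q (z - s) \<partial>measure_pmf p)"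
    by (intro nn_integral_eq_integral[symmetric] integrable_measure_pmf_bounded[where B = 1])
       (auto simp: pmf_le_1)
  also have "\<dots> \<le> (\<integral>\<^sup>+ s. ennreal (indicator S s * pmf q (z - s)) + ennreal M * indicator (- S) s \<partial>measure_pmf p)"
    by (intro nn_integral_mono) (auto simp: indicator_def M ennreal_leI)
  also have "\<dots> = (\<integral>\<^sup>+ s. ennreal (indicator S s * pmf q (z - s)) \<partial>measure_pmf p) +
      ennreal M * emeasure (measure_pmf p) (- S)"
    by (simp add: nn_integral_add nn_integral_cmult)
  also have "\<dots> \<le> ennreal b + ennreal M * emeasure (measure_pmf p) (- S)"
    by (intro add_right_mono on_S)
  also have "\<dots> = ennreal (b + M * measure (measure_pmf p) (- S))"
    using \<open>0 \<le> b\<close> \<open>0 \<le> M\<close> by (simp add: measure_pmf.emeasure_eq_measure ennreal_mult'[symmetric])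
  finally show ?thesis
    by (subst (asm) ennreal_le_iff) (auto intro!: add_nonneg_nonneg mult_nonneg_nonneg \<open>0 \<le> b\<close> \<open>0 \<le> M\<close>)
qed

text \<open>Conditioning on the first step that falls in \<open>S\<close>.\<close>

lemma pmf_walk_pmf_le_tail:
  assumes S: "\<And>s. s \<in> S \<Longrightarrow> pmf p s \<le> b" and "0 \<le> b" and pos: "0 < measure (measure_pmf p) S"
  shows "pmf (walk_pmf p n) z \<le>
    (1 - measure (measure_pmf p) S) ^ n + b / measure (measure_pmf p) S"
proof (induction n arbitrary: z)
  case 0
  have "pmf (walk_pmf p 0) z \<le> 1 + 0" by (simp add: pmf_le_1 del: walk_pmf.simps)
  also have "\<dots> \<le> 1 + b / measure (measure_pmf p) S" using assms by (intro add_left_mono) auto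
  finally show ?case by simp
next
  case (Suc n)
  let ?m = "measure (measure_pmf p) S"
  have "pmf (walk_pmf p (Suc n)) z \<le>
      b + ((1 - ?m) ^ n + b / ?m) * measure (measure_pmf p) (- S)"
    unfolding pmf_walk_pmf_Suc using \<open>0 \<le> b\<close>
    by (intro pmf_convolution_le Suc S) (auto intro!: add_nonneg_nonneg)
  also have "measure (measure_pmf p) (- S) = 1 - ?m"
    using measure_pmf.prob_compl[of S p] by (simp add: Compl_eq_Diff_UNIV)
  \<comment> \<open>\<open>b / ?m\<close> is the fixed point of the map sending \<open>y\<close> to
    \<open>b + y * (1 - ?m)\<close>.\<close>
  also have "b + ((1 - ?m) ^ n + b / ?m) * (1 - ?m) = (1 - ?m) ^ Suc n + b / ?m"
    using pos by (simp add: field_simps)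
  finally show ?case .
qed

text \<open>To get further than \<open>n * t\<close> in \<open>n\<close> steps, some step must be
  longer than \<open>t\<close>; each of its \<open>n\<close> possible positions contributes at most
  \<open>b\<close>.\<close>

lemma pmf_walk_pmf_le_far:
  assumes S: "\<And>s. t < \<bar>real_of_int s\<bar> \<Longrightarrow> pmf p s \<le> b" and "0 \<le> b"
    and "real n * t < \<bar>real_of_int z\<bar>"
  shows "pmf (walk_pmf p n) z \<le> real n * b"
  using assms(3)
proof (induction n arbitrary: z)
  case (Suc n)
  have "pmf (walk_pmf p (Suc n)) z \<le>
      b + real n * b * measure (measure_pmf p) (- {s. t < \<bar>real_of_int s\<bar>})"
    unfolding pmf_walk_pmf_Suc
  proof (rule pmf_convolution_le)
    fix s assume "s \<notin> {s. t < \<bar>real_of_int s\<bar>}"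
    then have "real n * t < \<bar>real_of_int (z - s)\<bar>"
      using Suc.prems by (simp add: algebra_simps)
    then show "pmf (walk_pmf p n) (z - s) \<le> real n * b" by (rule Suc.IH)
  qed (use S \<open>0 \<le> b\<close> in auto)
  also have "\<dots> \<le> b + real n * b * 1"
    using \<open>0 \<le> b\<close> by (intro add_left_mono mult_left_mono) auto
  finally show ?case by (simp add: algebra_simps)
qed simp

lemma sum_inverse_cubes_le:
  assumes "N \<ge> 1"
  shows "(\<Sum>k\<in>{N<..n}. 1 / real k ^ 3) \<le> 1 / real N ^ 2"
proof -
  \<comment> \<open>The subtracted \<open>1 / real n ^ 2\<close> makes the induction telescope: each
    new term is at most a difference of consecutive inverse squares.\<close>
  have "(\<Sum>k\<in>{N<..n}. 1 / real k ^ 3) \<le> 1 / real N ^ 2 - 1 / real n ^ 2" if "n \<ge> N"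
    using that
  proof (induction n rule: dec_induct)
    case (step n)
    have n: "real n \<ge> 1" using step assms by simp
    have "real n ^ 2 * (1 + real n) ^ 2 * 1 \<le> (1 + real n) ^ 3 * (1 + 2 * real n)"
    proof -
      have "real n ^ 2 \<le> (1 + real n) * (1 + 2 * real n)"
        using n by (simp add: algebra_simps power2_eq_square)
      then have "real n ^ 2 * (1 + real n) ^ 2 \<le> ((1 + real n) * (1 + 2 * real n)) * (1 + real n) ^ 2"
        by (rule mult_right_mono) simp
      then show ?thesis by (simp add: power3_eq_cube power2_eq_square mult_ac)
    qed
    then have "1 / (1 + real n) ^ 3 \<le> (1 + 2 * real n) / (real n ^ 2 * (1 + real n) ^ 2)"
      using n by (intro iffD2[OF divide_le_eq] ) (auto simp: field_simps)
    also have "\<dots> = 1 / real n ^ 2 - 1 / (1 + real n) ^ 2"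
    proof -
      have "1 + real n \<noteq> 0" "real n \<noteq> 0" using n by auto
      then show ?thesis
        by (subst diff_frac_eq, simp, simp) (simp add: algebra_simps power2_eq_square)
    qed
    finally have "1 / real (Suc n) ^ 3 \<le> 1 / real n ^ 2 - 1 / real (Suc n) ^ 2" by simp
    moreover have "{N<..Suc n} = insert (Suc n) {N<..n}" using step by auto
    ultimately show ?case using step.IH by simp
  qed simp
  then show ?thesis
    by (cases "n \<ge> N") (auto intro: order_trans)
qed

section \<open>Walks with polynomially decaying steps\<close>

locale stable_walk =
  fixes \<alpha> c0 C0 :: real and p :: "int pmf"
  assumes alpha: "0 < \<alpha>" "\<alpha> < 1/3" and sym: "symmetric_step p" and c0: "0 < c0" and C0: "c0 < C0"
    and pmf_ge: "x \<noteq> 0 \<Longrightarrow> c0 * \<bar>real_of_int x\<bar> powr (- 1 - \<alpha>) \<le> pmf p x"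
    and pmf_le: "x \<noteq> 0 \<Longrightarrow> pmf p x \<le> C0 * \<bar>real_of_int x\<bar> powr (- 1 - \<alpha>)"
begin

lemma C0_pos: "0 < C0" using c0 C0 by simp

text \<open>Only the \<open>t\<close> steps from \<open>t + 1\<close> to \<open>2 * t\<close> are
  counted, each of probability at least \<open>c0 * (2 * t) powr (- 1 - \<alpha>)\<close>. The
  factor 1/4 bounds \<open>2 powr (- 1 - \<alpha>)\<close> from below.\<close>

lemma measure_large_step_ge:
  fixes t :: nat
  assumes "t \<ge> 1"
  shows "c0 / 4 * real t powr (- \<alpha>) \<le> measure (measure_pmf p) {s. real t < \<bar>real_of_int s\<bar>}"
proof -
  have "c0 / 4 * real t powr (- \<alpha>) = real t * (c0 * (1/4 * real t powr (- 1 - \<alpha>)))"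
    using assms powr_add[of "real t" 1 "- 1 - \<alpha>"] by simp
  also have "\<dots> \<le> real t * (c0 * (2 powr (- 1 - \<alpha>) * real t powr (- 1 - \<alpha>)))"
  proof -
    have "(1/4 :: real) = 2 powr (- 2)" by (simp add: powr_minus powr_numeral)
    also have "\<dots> \<le> 2 powr (- 1 - \<alpha>)" using alpha by (intro powr_mono) auto
    finally show ?thesis using c0 by (intro mult_left_mono mult_right_mono) auto
  qed
  also have "\<dots> = (\<Sum>s\<in>{int t + 1..2 * int t}. c0 * (2 * real t) powr (- 1 - \<alpha>))"
    using assms by (simp add: powr_mult)
  also have "\<dots> \<le> (\<Sum>s\<in>{int t + 1..2 * int t}. pmf p s)"
  proof (rule sum_mono)
    fix s assume s: "s \<in> {int t + 1..2 * int t}"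
    have "c0 * (2 * real t) powr (- 1 - \<alpha>) \<le> c0 * \<bar>real_of_int s\<bar> powr (- 1 - \<alpha>)"
      using s c0 alpha by (intro mult_left_mono powr_mono2') auto
    also have "\<dots> \<le> pmf p s" using s by (intro pmf_ge) auto
    finally show "c0 * (2 * real t) powr (- 1 - \<alpha>) \<le> pmf p s" .
  qed
  also have "\<dots> = measure (measure_pmf p) {int t + 1..2 * int t}"
    by (simp add: measure_measure_pmf_finite)
  also have "\<dots> \<le> measure (measure_pmf p) {s. real t < \<bar>real_of_int s\<bar>}"
    by (intro measure_pmf.finite_measure_mono) auto
  finally show ?thesis .
qed

text \<open>The correct order is \<open>k powr (- 1 / \<alpha>)\<close>; the exponent \<open>3\<close> is smaller than \<open>1 / \<alpha>\<close>.\<close>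

lemma walk_pmf_le_cube:
  obtains D where "D > 0" "\<And>k z. k \<ge> 1 \<Longrightarrow> pmf (walk_pmf p k) z \<le> D / real k ^ 3"
proof -
  define c where "c = c0 / 4"
  \<comment> \<open>Among \<open>k\<close> steps, the expected number of those longer than
    \<open>k ^ 3\<close> is at least of order \<open>k powr d\<close>; the exponent is positive
    because \<alpha> < 1/3.\<close>
  define d where "d = 1 - 3 * \<alpha>"
  have "c > 0" "d > 0" using c0 alpha by (auto simp: c_def d_def)
  have "(\<lambda>k. real k ^ 3 * exp (- c * real k powr d)) \<longlonglongrightarrow> 0"
    using \<open>c > 0\<close> \<open>d > 0\<close> by real_asymp
  then have "Bseq (\<lambda>k. real k ^ 3 * exp (- c * real k powr d))"
    by (intro convergent_imp_Bseq) (auto simp: convergent_def)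
  then obtain E where "E > 0" and E: "\<And>k. real k ^ 3 * exp (- c * real k powr d) \<le> E"
    by (auto simp: Bseq_def)
  have "pmf (walk_pmf p k) z \<le> (E + C0 / c) / real k ^ 3" if "k \<ge> 1" for k z
  proof -
    \<comment> \<open>Some step length above \<open>t\<close> has probability at least of order
      \<open>t powr (- \<alpha>)\<close>, while each single one has at most
      \<open>C0 * t powr (- 1 - \<alpha>)\<close>. The quotient is of order \<open>1 / t\<close>,
      the desired inverse cube.\<close>
    define t where "t = k ^ 3"
    define S where "S = {s. real t < \<bar>real_of_int s\<bar>}"
    define m where "m = measure (measure_pmf p) S"
    define b where "b = C0 * real t powr (- 1 - \<alpha>)"
    have t: "t \<ge> 1" using that by (simp add: t_def)
    have m: "c * real t powr (- \<alpha>) \<le> m"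
      unfolding c_def m_def S_def by (rule measure_large_step_ge[OF t])
    have mpos: "c * real t powr (- \<alpha>) > 0" using t \<open>c > 0\<close> by simp
    have "m \<le> 1" by (simp add: m_def)
    have "pmf (walk_pmf p k) z \<le> (1 - m) ^ k + b / m"
      unfolding m_def
    proof (rule pmf_walk_pmf_le_tail)
      fix s assume s: "s \<in> S"
      have "pmf p s \<le> C0 * \<bar>real_of_int s\<bar> powr (- 1 - \<alpha>)"
        using s by (intro pmf_le) (auto simp: S_def)
      also have "\<dots> \<le> b"
        unfolding b_def using s t C0_pos alpha by (intro mult_left_mono powr_mono2') (auto simp: S_def)
      finally show "pmf p s \<le> b" .
    qed (use C0_pos m mpos in \<open>auto simp: b_def m_def\<close>)
    moreover have "(1 - m) ^ k \<le> E / real k ^ 3"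
    proof -
      have "(1 - m) ^ k \<le> exp (- m) ^ k"
        using \<open>m \<le> 1\<close> exp_ge_add_one_self[of "- m"] by (intro power_mono) auto
      also have "\<dots> = exp (- (real k * m))" by (simp add: exp_of_nat_mult[symmetric])
      also have "\<dots> \<le> exp (- (real k * (c * real t powr (- \<alpha>))))"
        using m by (simp add: mult_left_mono)
      also have "real k * (c * real t powr (- \<alpha>)) = c * real k powr d"
      proof -
        have "real t = real k powr 3" using that by (simp add: t_def powr_numeral)
        then have "real t powr (- \<alpha>) = real k powr (- 3 * \<alpha>)"
          by (simp only: powr_powr) simp
        moreover have "real k powr d = real k * real k powr (- 3 * \<alpha>)"
          using that powr_add[of "real k" 1 "- 3 * \<alpha>"] by (simp add: d_def)
        ultimately show ?thesis by simp
      qed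
      also have "exp (- (c * real k powr d)) \<le> E / real k ^ 3"
        using E[of k] that by (simp add: field_simps)
      finally show ?thesis .
    qed
    moreover have "b / m \<le> (C0 / c) / real k ^ 3"
    proof -
      have "b / m \<le> b / (c * real t powr (- \<alpha>))"
        using m mpos C0_pos by (intro divide_left_mono) (auto simp: b_def)
      also have "\<dots> = (C0 / c) * (real t powr (- 1 - \<alpha>) / real t powr (- \<alpha>))"
        by (simp add: b_def)
      also have "real t powr (- 1 - \<alpha>) / real t powr (- \<alpha>) = 1 / real t"
        using t by (subst powr_diff[symmetric]) (simp add: powr_minus_divide)
      finally show ?thesis by (simp add: t_def)
    qed
    ultimately show ?thesis by (simp add: add_divide_distrib)
  qed
  moreover have "E + C0 / c > 0" using \<open>E > 0\<close> \<open>c > 0\<close> C0_pos by (simp add: add_pos_pos)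
  ultimately show thesis by (rule that[rotated])
qed

text \<open>The sum is split at a time \<open>N\<close>. Up to \<open>N\<close>, reaching distance
  \<open>r\<close> takes a step longer than about \<open>r / N\<close>, which gives a total of order
  \<open>N ^ 3 / r\<close>; after \<open>N\<close> the inverse cubes sum to order
  \<open>1 / N ^ 2\<close>. Both are of order \<open>r powr (- 2/5)\<close> if \<open>N\<close> is
  about \<open>r powr (1/5)\<close>.\<close>

lemma green_function_le:
  obtains K where "K > 0"
    "\<And>n z. (\<Sum>k=1..n. pmf (walk_pmf p k) z) \<le> K * max 1 \<bar>real_of_int z\<bar> powr (- 2/5)"
proof -
  obtain D where "D > 0" and D: "\<And>k z. k \<ge> 1 \<Longrightarrow> pmf (walk_pmf p k) z \<le> D / real k ^ 3"
    using walk_pmf_le_cube by blast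
  have tail: "(\<Sum>k\<in>{N<..n}. pmf (walk_pmf p k) z) \<le> D / real N ^ 2" if "N \<ge> 1" for N n z
  proof -
    have "(\<Sum>k\<in>{N<..n}. pmf (walk_pmf p k) z) \<le> (\<Sum>k\<in>{N<..n}. D / real k ^ 3)"
      by (intro sum_mono D) auto
    also have "\<dots> = D * (\<Sum>k\<in>{N<..n}. 1 / real k ^ 3)" by (simp add: sum_distrib_left)
    also have "\<dots> \<le> D * (1 / real N ^ 2)"
      using sum_inverse_cubes_le[OF that, of n] \<open>D > 0\<close> by (intro mult_left_mono) auto
    finally show ?thesis by simp
  qed
  have "(\<Sum>k=1..n. pmf (walk_pmf p k) z) \<le> (2 * C0 + 4 * D) * max 1 \<bar>real_of_int z\<bar> powr (- 2/5)" for n z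
  proof (cases "z = 0")
    case True
    have "(\<Sum>k=1..n. pmf (walk_pmf p k) z) \<le> (\<Sum>k\<in>insert 1 {1<..n}. pmf (walk_pmf p k) z)"
      by (intro sum_mono2) auto
    also have "\<dots> = pmf (walk_pmf p 1) z + (\<Sum>k\<in>{1<..n}. pmf (walk_pmf p k) z)" by simp
    also have "\<dots> \<le> D + D" using tail[of 1 z n] D[of 1 z] by (intro add_mono) auto
    finally show ?thesis using True \<open>D > 0\<close> C0_pos by simp
  next
    case False
    define r where "r = \<bar>real_of_int z\<bar>"
    have r: "r \<ge> 1" using False by (simp add: r_def)
    define N where "N = nat \<lfloor>r powr (1/5)\<rfloor>"
    have r5: "r powr (1/5) \<ge> 1" using r by (simp add: ge_one_powr_ge_zero)
    have N1: "N \<ge> 1" using r5 by (simp add: N_def le_nat_iff le_floor_iff)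
    have N_le: "real N \<le> r powr (1/5)" using r5 by (simp add: N_def)
    have "0 < real N" using N1 by simp
    have N_ge: "r powr (1/5) / 2 \<le> real N"
    proof -
      have "r powr (1/5) < real N + 1" using r5 by (simp add: N_def)
      then show ?thesis using N1 by simp
    qed
    \<comment> \<open>The factor 2 keeps \<open>N * t\<close> strictly below \<open>r\<close>, as
      the bound for far points requires.\<close>
    define t where "t = r / (2 * real N)"
    have "t > 0" using r N1 by (simp add: t_def)
    have b: "pmf p s \<le> C0 / t" if "t < \<bar>real_of_int s\<bar>" for s
    proof -
      have s: "s \<noteq> 0" using that \<open>t > 0\<close> by auto
      then have "pmf p s \<le> C0 * \<bar>real_of_int s\<bar> powr (- 1 - \<alpha>)" by (rule pmf_le)
      also have "\<dots> \<le> C0 * \<bar>real_of_int s\<bar> powr (- 1)"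
        using s alpha C0_pos by (intro mult_left_mono powr_mono) auto
      also have "\<dots> = C0 / \<bar>real_of_int s\<bar>" using s by (simp add: powr_minus_divide)
      also have "\<dots> \<le> C0 / t" using that \<open>t > 0\<close> C0_pos by (intro divide_left_mono) auto
      finally show ?thesis .
    qed
    have "(\<Sum>k=1..n. pmf (walk_pmf p k) z) \<le> (\<Sum>k\<in>{1..N} \<union> {N<..n}. pmf (walk_pmf p k) z)"
      by (intro sum_mono2) auto
    also have "\<dots> = (\<Sum>k\<in>{1..N}. pmf (walk_pmf p k) z) + (\<Sum>k\<in>{N<..n}. pmf (walk_pmf p k) z)"
      by (intro sum.union_disjoint) auto
    also have "\<dots> \<le> 2 * C0 * r powr (- 2/5) + 4 * D * r powr (- 2/5)"
    proof (rule add_mono)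
      have "(\<Sum>k\<in>{1..N}. pmf (walk_pmf p k) z) \<le> (\<Sum>k\<in>{1..N}. real N * (C0 / t))"
      proof (rule sum_mono)
        fix k assume k: "k \<in> {1..N}"
        have "real k * t \<le> real N * t" using k \<open>t > 0\<close> by (intro mult_right_mono) auto
        also have "\<dots> < \<bar>real_of_int z\<bar>" using N1 r by (simp add: t_def r_def[symmetric])
        finally have "pmf (walk_pmf p k) z \<le> real k * (C0 / t)"
          using b C0_pos \<open>t > 0\<close> by (intro pmf_walk_pmf_le_far[where t = t]) auto
        also have "\<dots> \<le> real N * (C0 / t)"
          using k C0_pos \<open>t > 0\<close> by (intro mult_right_mono) auto
        finally show "pmf (walk_pmf p k) z \<le> real N * (C0 / t)" .
      qed
      also have "\<dots> = 2 * C0 * (real N ^ 3 / r)"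
        using N1 r by (simp add: t_def power3_eq_cube)
      also have "\<dots> \<le> 2 * C0 * (r powr (3/5) / r)"
      proof -
        have "real N ^ 3 \<le> (r powr (1/5)) ^ 3" using N_le by (intro power_mono) auto
        also have "\<dots> = r powr (3/5)" using r by (simp add: powr_powr flip: powr_numeral)
        finally show ?thesis using C0_pos r by (intro mult_left_mono divide_right_mono) auto
      qed
      also have "r powr (3/5) / r = r powr (- 2/5)"
        using r powr_diff[of r "3/5" 1] by simp
      finally show "(\<Sum>k\<in>{1..N}. pmf (walk_pmf p k) z) \<le> 2 * C0 * r powr (- 2/5)" .
      have "(\<Sum>k\<in>{N<..n}. pmf (walk_pmf p k) z) \<le> D / real N ^ 2" by (rule tail[OF N1])
      also have "\<dots> \<le> D / (r powr (1/5) / 2) ^ 2"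
        using N_ge \<open>D > 0\<close> r5 \<open>0 < real N\<close>
        by (intro divide_left_mono power_mono mult_pos_pos zero_less_power) auto
      also have "\<dots> = 4 * D * (1 / (r powr (1/5)) ^ 2)" by (simp add: power_divide)
      also have "1 / (r powr (1/5)) ^ 2 = r powr (- 2/5)"
        using r by (simp add: powr_powr powr_minus_divide flip: powr_numeral)
      finally show "(\<Sum>k\<in>{N<..n}. pmf (walk_pmf p k) z) \<le> 4 * D * r powr (- 2/5)" by simp
    qed
    also have "\<dots> = (2 * C0 + 4 * D) * max 1 \<bar>real_of_int z\<bar> powr (- 2/5)"
      using r by (simp add: r_def algebra_simps max_def)
    finally show ?thesis .
  qed
  then show thesis using C0_pos \<open>D > 0\<close> by (intro that[of "2 * C0 + 4 * D"]) auto
qed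

end

section \<open>Escape from sparse sets\<close>

lemma sum_powr_minus_two_fifths_le: "(\<Sum>j=1..n. real j powr (- 2/5)) \<le> 2 * real n powr (3/5)"
proof (induction n)
  case (Suc n)
  have "real n powr (3/5) + 1/2 * (1 + real n) powr (- 2/5) \<le> (1 + real n) powr (3/5)"
  proof (cases "n = 0")
    case False
    define v where "v = (1 + real n) powr (2/5)"
    have "v > 0" by (simp add: v_def)
    \<comment> \<open>Young's inequality with weights 3/5 and 2/5 stands for the concavity of the
      power 3/5: it bounds the increment of that power from below.\<close>
    have "real n powr (3/5) * v \<le> 3/5 * real n + 2/5 * (1 + real n)"
      unfolding v_def using False by (intro Youngs_inequality_0) auto
    also have "\<dots> \<le> (1 + real n) - 1/2" by (simp add: field_simps)
    also have "1 + real n = (1 + real n) powr (3/5) * v"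
      unfolding v_def by (simp flip: powr_add)
    finally have "real n powr (3/5) + 1/2 * (1 / v) \<le> (1 + real n) powr (3/5)"
      using \<open>v > 0\<close> by (simp add: field_simps)
    also have "1 / v = (1 + real n) powr (- 2/5)"
      by (simp add: v_def powr_minus_divide)
    finally show ?thesis .
  qed simp
  then show ?case using Suc by simp
qed simp

text \<open>The element of rank \<open>j\<close> satisfies \<open>f s \<ge> (j / c) ^ 3\<close>.\<close>

lemma sum_powr_le_of_counting:
  fixes f :: "'a \<Rightarrow> real"
  assumes "finite S" "c > 0" and pos: "\<And>s. s \<in> S \<Longrightarrow> f s > 0"
    and count: "\<And>s. s \<in> S \<Longrightarrow> real (card {s' \<in> S. f s' \<le> f s}) \<le> c * f s powr (1/3)"
  shows "(\<Sum>s\<in>S. f s powr (- 2/5)) \<le> c powr (6/5) * (\<Sum>j=1..card S. real j powr (- 6/5))"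
  using assms(1) pos count
proof (induction S rule: finite_ranking_induct[where f = f])
  case (insert s S)
  show ?case
  proof (cases "s \<in> S")
    case True
    then show ?thesis using insert by (simp add: insert_absorb)
  next
    case False
    let ?k = "card (insert s S)"
    have k: "?k = Suc (card S)" using False insert.hyps by simp
    have fs: "f s > 0" using insert.prems by simp
    \<comment> \<open>The ranking induction inserts an element of maximal value, so the counting
      hypothesis at \<open>s\<close> counts the whole set.\<close>
    have "{s' \<in> insert s S. f s' \<le> f s} = insert s S" using insert.hyps by auto
    then have "real ?k \<le> c * f s powr (1/3)" using insert.prems(2)[of s] by simp
    then have "real ?k powr (6/5) \<le> (c * f s powr (1/3)) powr (6/5)"
      by (intro powr_mono2) auto
    also have "\<dots> = c powr (6/5) * f s powr (2/5)"
      using \<open>c > 0\<close> fs by (simp add: powr_mult powr_powr)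
    finally have "f s powr (- 2/5) \<le> c powr (6/5) * real ?k powr (- 6/5)"
      using fs k by (simp add: powr_minus field_simps)
    moreover have "(\<Sum>s\<in>S. f s powr (- 2/5)) \<le> c powr (6/5) * (\<Sum>j=1..card S. real j powr (- 6/5))"
    proof (rule insert.IH)
      fix t assume "t \<in> S"
      have "card {s' \<in> S. f s' \<le> f t} \<le> card {s' \<in> insert s S. f s' \<le> f t}"
        using insert.hyps by (intro card_mono) auto
      then show "real (card {s' \<in> S. f s' \<le> f t}) \<le> c * f t powr (1/3)"
        using insert.prems(2)[of t] \<open>t \<in> S\<close> by simp
    qed (use insert.prems in auto)
    ultimately show ?thesis
      using False insert.hyps by (simp add: k algebra_simps)
  qed
qed simp

text \<open>Averaging over a window of length \<open>L\<close> removes the peak of the kernel below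
  scale \<open>L\<close>. If \<open>b\<close> is far from the window, all distances are comparable;
  otherwise the sum is at most one over integers within \<open>3 * L\<close>, of order
  \<open>L powr (3/5)\<close>. The constant is 6 * 3 * 2, from the second case.\<close>

lemma sum_kernel_interval_le:
  fixes x b :: int and L :: nat
  assumes "L \<ge> 1"
  shows "(\<Sum>y\<in>{x..<x + int L}. max 1 \<bar>real_of_int (b - y)\<bar> powr (- 2/5)) \<le>
    36 * real L * max (real L) \<bar>real_of_int (b - x)\<bar> powr (- 2/5)"
proof (cases "\<bar>b - x\<bar> \<ge> 2 * int L")
  case True
  define r where "r = \<bar>real_of_int (b - x)\<bar>"
  have r: "r \<ge> 2 * real L"
    using True unfolding r_def by linarith
  have "(\<Sum>y\<in>{x..<x + int L}. max 1 \<bar>real_of_int (b - y)\<bar> powr (- 2/5)) \<le>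
      (\<Sum>y\<in>{x..<x + int L}. 2 * r powr (- 2/5))"
  proof (rule sum_mono)
    fix y assume "y \<in> {x..<x + int L}"
    then have "x \<le> y" "y < x + int L" by auto
    then have "\<bar>b - x\<bar> \<le> 2 * \<bar>b - y\<bar>" using True by (simp add: abs_if split: if_splits)
    then have "r \<le> 2 * \<bar>real_of_int (b - y)\<bar>" unfolding r_def by linarith
    then have "max 1 \<bar>real_of_int (b - y)\<bar> powr (- 2/5) \<le> (r / 2) powr (- 2/5)"
      using r assms by (intro powr_mono2') auto
    also have "\<dots> = 2 powr (2/5) * r powr (- 2/5)"
      using r by (simp add: powr_divide powr_minus field_simps)
    also have "\<dots> \<le> 2 powr 1 * r powr (- 2/5)"
      by (intro mult_right_mono powr_mono) auto
    finally show "max 1 \<bar>real_of_int (b - y)\<bar> powr (- 2/5) \<le> 2 * r powr (- 2/5)" by simp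
  qed
  also have "\<dots> = 2 * real L * r powr (- 2/5)" by simp
  also have "\<dots> \<le> 36 * real L * r powr (- 2/5)" by (intro mult_right_mono) auto
  also have "r = max (real L) \<bar>real_of_int (b - x)\<bar>" using r by (simp add: r_def)
  finally show ?thesis .
next
  case False
  let ?g = "\<lambda>z. max 1 \<bar>real_of_int z\<bar> powr (- 2/5)"
  define N where "N = 3 * L"
  have half: "(\<Sum>z\<in>(\<lambda>j. s * int j) ` {0..N}. ?g z) \<le> 3 * real N powr (3/5)" if "\<bar>s\<bar> = 1" for s :: int
  proof -
    have "(\<Sum>z\<in>(\<lambda>j. s * int j) ` {0..N}. ?g z) = (\<Sum>j\<in>{0..N}. max 1 (real j) powr (- 2/5))"
      using that by (subst sum.reindex) (auto simp: inj_on_def abs_mult simp flip: of_int_abs)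
    also have "\<dots> = 1 + (\<Sum>j=1..N. max 1 (real j) powr (- 2/5))"
      by (simp add: sum.atLeast_Suc_atMost)
    also have "(\<Sum>j=1..N. max 1 (real j) powr (- 2/5)) = (\<Sum>j=1..N. real j powr (- 2/5))"
      by (intro sum.cong) (auto simp: max_def)
    also have "\<dots> \<le> 2 * real N powr (3/5)" by (rule sum_powr_minus_two_fifths_le)
    also have "1 \<le> real N powr (3/5)" using assms by (simp add: N_def ge_one_powr_ge_zero)
    finally show ?thesis by simp
  qed
  have "(\<Sum>y\<in>{x..<x + int L}. ?g (b - y)) = (\<Sum>z\<in>(\<lambda>y. b - y) ` {x..<x + int L}. ?g z)"
    by (subst sum.reindex) (auto simp: inj_on_def)
  \<comment> \<open>The differences \<open>b - y\<close> are covered by two segments indexed by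
    natural numbers; the point 0 belongs to both.\<close>
  also have "\<dots> \<le> (\<Sum>z\<in>(\<lambda>j. 1 * int j) ` {0..N} \<union> (\<lambda>j. (- 1) * int j) ` {0..N}. ?g z)"
  proof (rule sum_mono2)
    show "(\<lambda>y. b - y) ` {x..<x + int L} \<subseteq> (\<lambda>j. 1 * int j) ` {0..N} \<union> (\<lambda>j. (- 1) * int j) ` {0..N}"
    proof safe
      fix y assume y: "y \<in> {x..<x + int L}" and n: "b - y \<notin> (\<lambda>j. (- 1) * int j) ` {0..N}"
      have bd: "\<bar>b - y\<bar> \<le> int N" using y False by (auto simp: N_def)
      have "b - y \<ge> 0"
      proof (rule ccontr)
        assume "\<not> b - y \<ge> 0"
        then have "b - y = (- 1) * int (nat (y - b))" "nat (y - b) \<in> {0..N}" using bd by auto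
        then show False using n by blast
      qed
      then show "b - y \<in> (\<lambda>j. 1 * int j) ` {0..N}"
        using bd by (intro image_eqI[of _ _ "nat (b - y)"]) auto
    qed
  qed auto
  also have "\<dots> \<le> (\<Sum>z\<in>(\<lambda>j. 1 * int j) ` {0..N}. ?g z) + (\<Sum>z\<in>(\<lambda>j. (- 1) * int j) ` {0..N}. ?g z)"
    by (subst sum.union_inter[symmetric]) (auto intro!: sum_nonneg)
  also have "\<dots> \<le> 3 * real N powr (3/5) + 3 * real N powr (3/5)"
    by (intro add_mono half) auto
  also have "\<dots> = 6 * (3 powr (3/5) * real L powr (3/5))" by (simp add: N_def powr_mult)
  also have "\<dots> \<le> 6 * (3 powr 1 * real L powr (3/5))"
    by (intro mult_left_mono mult_right_mono powr_mono) auto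
  also have "real L powr (3/5) = real L * real L powr (- 2/5)"
    using assms powr_add[of "real L" 1 "- 2/5"] by simp
  also have "real L powr (- 2/5) \<le> 2 * max (real L) \<bar>real_of_int (b - x)\<bar> powr (- 2/5)"
  proof -
    have "max (real L) \<bar>real_of_int (b - x)\<bar> \<le> 2 * real L" using False by linarith
    then have "(2 * real L) powr (- 2/5) \<le> max (real L) \<bar>real_of_int (b - x)\<bar> powr (- 2/5)"
      using assms by (intro powr_mono2') auto
    moreover have "(2 * real L) powr (- 2/5) = 2 powr (- 2/5) * real L powr (- 2/5)"
      by (simp add: powr_mult)
    moreover have "2 powr (- 1) * real L powr (- 2/5) \<le> 2 powr (- 2/5) * real L powr (- 2/5)"
      by (intro mult_right_mono powr_mono) auto
    ultimately show ?thesis by (simp add: powr_minus)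
  qed
  finally show ?thesis using assms by (simp add: mult_left_mono)
qed

section \<open>Escape and attachment in sparse windows\<close>

context stable_walk
begin

lemma escape_prob_ge:
  obtains K where "K > 0"
    "\<And>A x. finite A \<Longrightarrow>
      1 - K * (\<Sum>b\<in>A. max 1 \<bar>real_of_int (b - x)\<bar> powr (- 2/5)) \<le> escape_prob p A x"
proof -
  obtain K where "K > 0"
    and K: "\<And>n z. (\<Sum>k=1..n. pmf (walk_pmf p k) z) \<le> K * max 1 \<bar>real_of_int z\<bar> powr (- 2/5)"
    using green_function_le by blast
  have "1 - K * (\<Sum>b\<in>A. max 1 \<bar>real_of_int (b - x)\<bar> powr (- 2/5)) \<le> escape_prob p A x"
    if "finite A" for A x
  proof (rule LIMSEQ_le_const[OF avoid_prob_tendsto], intro exI allI impI)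
    fix n :: nat
    have "1 - avoid_prob p A n x \<le> (\<Sum>k=1..n. \<Sum>b\<in>A. pmf (walk_pmf p k) (b - x))"
      by (rule one_minus_avoid_prob_le[OF that])
    also have "\<dots> = (\<Sum>b\<in>A. \<Sum>k=1..n. pmf (walk_pmf p k) (b - x))" by (rule sum.swap)
    also have "\<dots> \<le> (\<Sum>b\<in>A. K * max 1 \<bar>real_of_int (b - x)\<bar> powr (- 2/5))"
      by (intro sum_mono K)
    finally show "1 - K * (\<Sum>b\<in>A. max 1 \<bar>real_of_int (b - x)\<bar> powr (- 2/5)) \<le> avoid_prob p A n x"
      by (simp add: sum_distrib_left)
  qed
  then show thesis using that \<open>K > 0\<close> by blast
qed

text \<open>After exchanging sums, the union bound over the window becomes one sum over
  \<open>A\<close> of the kernel smoothed at scale \<open>L\<close>. Sparsity bounds it by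
  \<open>c powr (6/5)\<close> times a partial sum of \<open>j powr (- 6/5)\<close>; this series
  converges because 1/3 < 2/5, so the loss is small with \<open>c\<close>.\<close>

lemma sum_escape_prob_sparse:
  obtains c where "c > 0" "c \<le> 1"
    "\<And>A x (L :: nat). finite A \<Longrightarrow> L \<ge> 1 \<Longrightarrow>
      (\<And>v :: nat. v \<ge> L \<Longrightarrow> real (card (A \<inter> {x - int v..x + int v})) \<le> c * real v powr (1/3)) \<Longrightarrow>
      3/4 * real L \<le> (\<Sum>y\<in>{x..<x + int L}. escape_prob p A y)"
proof -
  obtain K where "K > 0"
    and K: "\<And>A x. finite A \<Longrightarrow>
      1 - K * (\<Sum>b\<in>A. max 1 \<bar>real_of_int (b - x)\<bar> powr (- 2/5)) \<le> escape_prob p A x"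
    using escape_prob_ge by blast
  define Z where "Z = (\<Sum>j. real j powr (- 6/5)) + 1"
  have summ: "summable (\<lambda>j. real j powr (- 6/5))" by (subst summable_real_powr_iff) simp
  have Z: "(\<Sum>j=1..n. real j powr (- 6/5)) \<le> Z" for n
    using sum_le_suminf[OF summ, of "{1..n}"] by (simp add: Z_def)
  have "Z \<ge> 1" using suminf_nonneg[OF summ] by (simp add: Z_def)
  \<comment> \<open>Chosen so that the loss \<open>K * 36 * L * c powr (6/5) * Z\<close> is at most
    \<open>L / 4\<close>; 144 is 4 * 36.\<close>
  define c where "c = min 1 ((1 / (144 * K * Z)) powr (5/6))"
  have "c > 0" using \<open>K > 0\<close> \<open>Z \<ge> 1\<close> by (simp add: c_def)
  have c65: "c powr (6/5) \<le> 1 / (144 * K * Z)"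
  proof -
    have "c powr (6/5) \<le> ((1 / (144 * K * Z)) powr (5/6)) powr (6/5)"
      using \<open>c > 0\<close> by (intro powr_mono2) (auto simp: c_def)
    also have "\<dots> = 1 / (144 * K * Z)"
      using \<open>K > 0\<close> \<open>Z \<ge> 1\<close> by (simp only: powr_powr) simp
    finally show ?thesis .
  qed
  have "3/4 * real L \<le> (\<Sum>y\<in>{x..<x + int L}. escape_prob p A y)"
    if A: "finite A" and L: "L \<ge> 1"
      and sparse: "\<And>v :: nat. v \<ge> L \<Longrightarrow> real (card (A \<inter> {x - int v..x + int v})) \<le> c * real v powr (1/3)"
    for A x and L :: nat
  proof -
    \<comment> \<open>Distances are cut off below at \<open>L\<close>, so that sparsity is required
      only for radii \<open>v \<ge> L\<close>.\<close>
    let ?f = "\<lambda>b. max (real L) \<bar>real_of_int (b - x)\<bar>"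
    have "(\<Sum>b\<in>A. ?f b powr (- 2/5)) \<le> c powr (6/5) * (\<Sum>j=1..card A. real j powr (- 6/5))"
    proof (rule sum_powr_le_of_counting[OF A \<open>c > 0\<close>])
      show "?f b > 0" for b using L by simp
      fix b
      define v where "v = max L (nat \<bar>b - x\<bar>)"
      have v: "?f b = real v" by (simp add: v_def max_def) linarith
      have "{b' \<in> A. ?f b' \<le> ?f b} \<subseteq> A \<inter> {x - int v..x + int v}"
        unfolding v by (auto; linarith)
      then have "card {b' \<in> A. ?f b' \<le> ?f b} \<le> card (A \<inter> {x - int v..x + int v})"
        using A by (intro card_mono) auto
      also have "real \<dots> \<le> c * real v powr (1/3)" by (rule sparse) (simp add: v_def)
      finally show "real (card {b' \<in> A. ?f b' \<le> ?f b}) \<le> c * ?f b powr (1/3)"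
        unfolding v by simp
    qed
    also have "\<dots> \<le> 1 / (144 * K * Z) * Z"
      using c65 \<open>K > 0\<close> \<open>Z \<ge> 1\<close> by (intro mult_mono Z) (auto intro!: sum_nonneg)
    also have "\<dots> = 1 / (144 * K)" using \<open>Z \<ge> 1\<close> by simp
    finally have f: "(\<Sum>b\<in>A. ?f b powr (- 2/5)) \<le> 1 / (144 * K)" .
    have "(\<Sum>y\<in>{x..<x + int L}. \<Sum>b\<in>A. max 1 \<bar>real_of_int (b - y)\<bar> powr (- 2/5)) =
        (\<Sum>b\<in>A. \<Sum>y\<in>{x..<x + int L}. max 1 \<bar>real_of_int (b - y)\<bar> powr (- 2/5))"
      by (rule sum.swap)
    also have "\<dots> \<le> (\<Sum>b\<in>A. 36 * real L * ?f b powr (- 2/5))"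
      by (intro sum_mono sum_kernel_interval_le L)
    also have "\<dots> = 36 * real L * (\<Sum>b\<in>A. ?f b powr (- 2/5))" by (simp add: sum_distrib_left)
    also have "\<dots> \<le> 36 * real L * (1 / (144 * K))" by (intro mult_left_mono f) auto
    finally have "K * (\<Sum>y\<in>{x..<x + int L}. \<Sum>b\<in>A. max 1 \<bar>real_of_int (b - y)\<bar> powr (- 2/5)) \<le> real L / 4"
      using \<open>K > 0\<close> by (simp add: field_simps)
    then have "3/4 * real L \<le>
        (\<Sum>y\<in>{x..<x + int L}. 1 - K * (\<Sum>b\<in>A. max 1 \<bar>real_of_int (b - y)\<bar> powr (- 2/5)))"
      by (simp add: sum_subtractf sum_distrib_left)
    also have "\<dots> \<le> (\<Sum>y\<in>{x..<x + int L}. escape_prob p A y)" by (intro sum_mono K A)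
    finally show ?thesis .
  qed
  moreover have "c \<le> 1" by (simp add: c_def)
  ultimately show thesis using that \<open>c > 0\<close> by blast
qed

text \<open>At most half of the window lies outside \<open>W\<close>, so \<open>W\<close> retains at
  least \<open>L / 4\<close> of the total escape probability. Every site of \<open>W\<close> is
  within \<open>2 * L\<close> of each counted point of \<open>A\<close>, which gives a factor
  \<open>c0 * (2 * L) powr (- 1 - \<alpha>)\<close> per point.\<close>

lemma sum_attachment_ge:
  fixes x :: int and L :: nat
  assumes A: "finite A" and L: "L \<ge> 1"
    and esc: "3/4 * real L \<le> (\<Sum>y\<in>{x..<x + int L}. escape_prob p A y)"
    and W: "W \<subseteq> {x..<x + int L} - A" and card: "2 * card ({x..<x + int L} - W) \<le> L"
  shows "c0 / 16 * real (card (A \<inter> {x - int L..x + int L})) * real L powr (- \<alpha>) \<le>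
    (\<Sum>z\<in>W. \<Sum>a\<in>A. step_prob p z a * escape_prob p A z)"
proof -
  let ?I = "{x..<x + int L}" and ?N = "A \<inter> {x - int L..x + int L}"
  let ?q = "c0 * (2 * real L) powr (- 1 - \<alpha>)"
  have "W \<subseteq> ?I" using W by blast
  have "(\<Sum>y\<in>?I - W. escape_prob p A y) \<le> real (card (?I - W))"
    using sum_bounded_above[of "?I - W" "escape_prob p A" 1] escape_prob_bounds by simp
  also have "\<dots> \<le> real L / 2" using card by linarith
  finally have "real L / 4 \<le> (\<Sum>y\<in>W. escape_prob p A y)"
    using esc sum.subset_diff[OF \<open>W \<subseteq> ?I\<close>, of "escape_prob p A"] by simp
  have "c0 / 16 * real (card ?N) * real L powr (- \<alpha>) \<le> real (card ?N) * (?q * (real L / 4))"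
  proof -
    have "c0 / 16 * real L powr (- \<alpha>) = c0 * (1/4 * real L powr (- 1 - \<alpha>)) * (real L / 4)"
      using L powr_add[of "real L" 1 "- 1 - \<alpha>"] by simp
    also have "\<dots> \<le> c0 * (2 powr (- 1 - \<alpha>) * real L powr (- 1 - \<alpha>)) * (real L / 4)"
    proof -
      have "(1/4 :: real) = 2 powr (- 2)" by (simp add: powr_minus powr_numeral)
      also have "\<dots> \<le> 2 powr (- 1 - \<alpha>)" using alpha by (intro powr_mono) auto
      finally show ?thesis using c0 by (intro mult_left_mono mult_right_mono) auto
    qed
    also have "\<dots> = ?q * (real L / 4)" by (simp add: powr_mult)
    finally have "c0 / 16 * real L powr (- \<alpha>) \<le> ?q * (real L / 4)" .
    from mult_left_mono[OF this, of "real (card ?N)"] show ?thesis by (simp add: mult_ac)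
  qed
  also have "\<dots> \<le> real (card ?N) * (?q * (\<Sum>z\<in>W. escape_prob p A z))"
    using \<open>real L / 4 \<le> _\<close> c0 by (intro mult_left_mono) auto
  also have "\<dots> = (\<Sum>z\<in>W. \<Sum>a\<in>?N. ?q * escape_prob p A z)"
    by (simp add: sum_distrib_left sum_distrib_right mult_ac)
  also have "\<dots> \<le> (\<Sum>z\<in>W. \<Sum>a\<in>?N. step_prob p z a * escape_prob p A z)"
  proof (intro sum_mono mult_right_mono escape_prob_bounds)
    fix z a assume z: "z \<in> W" and a: "a \<in> ?N"
    have ne: "a - z \<noteq> 0" using z a W by auto
    have "z \<in> ?I" using z W by blast
    then have "\<bar>a - z\<bar> \<le> 2 * int L" using a by auto
    then have le: "\<bar>real_of_int (a - z)\<bar> \<le> 2 * real L" by linarith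
    have "?q \<le> c0 * \<bar>real_of_int (a - z)\<bar> powr (- 1 - \<alpha>)"
      using le ne alpha c0 by (intro mult_left_mono powr_mono2') auto
    also have "\<dots> \<le> pmf p (a - z)" by (rule pmf_ge[OF ne])
    finally show "?q \<le> step_prob p z a" by (simp add: step_prob_eq_pmf)
  qed
  also have "\<dots> \<le> (\<Sum>z\<in>W. \<Sum>a\<in>A. step_prob p z a * escape_prob p A z)"
    by (intro sum_mono sum_mono2 A) (auto simp: step_prob_eq_pmf escape_prob_bounds)
  finally show ?thesis .
qed

text \<open>At a large scale every finite set is sparse, so the free sites of a window have positive
  total attachment weight. This weight is part of a sum equal to the capacity.\<close>

lemma capacity_pos:
  assumes A: "finite A" "A \<noteq> {}"
  shows "0 < capacity p A"
proof -
  obtain c where "c > 0" "c \<le> 1" and c: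
    "\<And>A x (L :: nat). finite A \<Longrightarrow> L \<ge> 1 \<Longrightarrow>
      (\<And>v :: nat. v \<ge> L \<Longrightarrow> real (card (A \<inter> {x - int v..x + int v})) \<le> c * real v powr (1/3)) \<Longrightarrow>
      3/4 * real L \<le> (\<Sum>y\<in>{x..<x + int L}. escape_prob p A y)"
    using sum_escape_prob_sparse by blast
  obtain L0 where L0: "(real (card A) / c) ^ 3 \<le> real L0" using real_arch_simple by blast
  \<comment> \<open>\<open>L0\<close> makes \<open>A\<close> sparse from scale \<open>L\<close> on;
    the other entry ensures that \<open>A\<close> fills at most half of the window.\<close>
  define L where "L = max L0 (2 * card A + 1)"
  obtain a where "a \<in> A" using A by blast
  have "3/4 * real L \<le> (\<Sum>y\<in>{a..<a + int L}. escape_prob p A y)"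
  proof (rule c[OF A(1)])
    show "L \<ge> 1" by (simp add: L_def)
    fix v assume v: "v \<ge> L"
    have "(real (card A) / c) ^ 3 \<le> real v" using L0 v by (simp add: L_def)
    have "real (card A) / c = ((real (card A) / c) ^ 3) powr (1/3)"
      using A \<open>c > 0\<close> by (simp add: card_gt_0_iff powr_powr flip: powr_numeral)
    also have "\<dots> \<le> real v powr (1/3)"
      using \<open>c > 0\<close> \<open>_ \<le> real v\<close> by (intro powr_mono2) auto
    finally have "real (card A) \<le> c * real v powr (1/3)" using \<open>c > 0\<close> by (simp add: field_simps)
    moreover have "card (A \<inter> {a - int v..a + int v}) \<le> card A" using A by (intro card_mono) auto
    ultimately show "real (card (A \<inter> {a - int v..a + int v})) \<le> c * real v powr (1/3)" by linarith
  qed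
  moreover have "2 * card ({a..<a + int L} - ({a..<a + int L} - A)) \<le> L"
  proof -
    have "card ({a..<a + int L} - ({a..<a + int L} - A)) \<le> card A" using A by (intro card_mono) auto
    then show ?thesis by (simp add: L_def)
  qed
  ultimately have le: "c0 / 16 * real (card (A \<inter> {a - int L..a + int L})) * real L powr (- \<alpha>) \<le>
      (\<Sum>z\<in>{a..<a + int L} - A. \<Sum>b\<in>A. step_prob p z b * escape_prob p A z)"
    by (intro sum_attachment_ge A) (auto simp: L_def)
  have "card (A \<inter> {a - int L..a + int L}) > 0"
    using A \<open>a \<in> A\<close> by (subst card_gt_0_iff) auto
  then have "0 < c0 / 16 * real (card (A \<inter> {a - int L..a + int L})) * real L powr (- \<alpha>)"
    using c0 by (simp add: L_def)
  with le have pos: "0 < (\<Sum>z\<in>{a..<a + int L} - A. \<Sum>b\<in>A. step_prob p z b * escape_prob p A z)" by linarith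
  have "ennreal (\<Sum>z\<in>{a..<a + int L} - A. \<Sum>b\<in>A. step_prob p z b * escape_prob p A z) =
      (\<integral>\<^sup>+ z. ennreal (\<Sum>b\<in>A. step_prob p z b * escape_prob p A z) \<partial>count_space ({a..<a + int L} - A))"
    by (subst nn_integral_count_space_finite)
       (auto intro!: sum_ennreal[symmetric] sum_nonneg simp: step_prob_eq_pmf escape_prob_bounds)
  also have "\<dots> \<le> (\<integral>\<^sup>+ z. ennreal (indicator (- A) z * (\<Sum>b\<in>A. step_prob p z b * escape_prob p A z)) \<partial>count_space UNIV)"
    unfolding nn_integral_count_space_indicator[of "{a..<a + int L} - A", simplified]
    by (intro nn_integral_mono) (auto simp: indicator_def)
  also have "\<dots> = ennreal (capacity p A)" by (rule nn_integral_attachment[OF sym A(1)])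
  finally have "(\<Sum>z\<in>{a..<a + int L} - A. \<Sum>b\<in>A. step_prob p z b * escape_prob p A z) \<le> capacity p A"
    by (subst (asm) ennreal_le_iff) (rule capacity_nonneg)
  with pos show ?thesis by linarith
qed

end

section \<open>Dense scales\<close>

text \<open>One radius suffices for density; hence the negation is sparsity at every radius from
  \<open>l\<close> on, which is what makes escape likely.\<close>

definition dense_around :: "real \<Rightarrow> nat \<Rightarrow> int set \<Rightarrow> int \<Rightarrow> bool" where
  "dense_around c l A x \<longleftrightarrow>
     (\<exists>v\<ge>l. c * real v powr (1/3) \<le> real (card (A \<inter> {x - int v..x + int v})))"

definition occupied_cells :: "nat \<Rightarrow> nat \<Rightarrow> int set \<Rightarrow> int \<Rightarrow> int set" where
  "occupied_cells l L A x = (\<lambda>a. (a - x) div int l) ` (A \<inter> {x..<x + int L})"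

lemma dense_around_mono:
  assumes "dense_around c l A x" "A \<subseteq> B" "finite B" "c' \<le> c" "l' \<le> l"
  shows "dense_around c' l' B x"
proof -
  obtain v where v: "v \<ge> l" "c * real v powr (1/3) \<le> real (card (A \<inter> {x - int v..x + int v}))"
    using assms(1) by (auto simp: dense_around_def)
  have "c' * real v powr (1/3) \<le> c * real v powr (1/3)" using assms(4) by (intro mult_right_mono) auto
  moreover have "card (A \<inter> {x - int v..x + int v}) \<le> card (B \<inter> {x - int v..x + int v})"
    using assms by (intro card_mono) auto
  ultimately have "c' * real v powr (1/3) \<le> real (card (B \<inter> {x - int v..x + int v}))"
    using v by linarith
  then show ?thesis unfolding dense_around_def using v assms(5) by (intro exI[of _ v]) auto
qed

text \<open>The points of \<open>Y\<close> lie in different cells of length \<open>l\<close>, and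
  the window meets at most \<open>w / l + 2\<close> cells, the ends being possibly cut.\<close>

lemma card_le_of_div_window:
  fixes Y :: "int set"
  assumes "l \<ge> 1" and inj: "inj_on (\<lambda>y. (y - x) div int l) Y" and Y: "Y \<subseteq> {a..a + int w}"
  shows "l * card Y \<le> w + 2 * l"
proof -
  have finY: "finite Y" using Y finite_subset by blast
  let ?h = "\<lambda>y. (y - x) div int l"
  have "?h ` Y \<subseteq> {?h a..?h (a + int w)}"
  proof
    fix j assume "j \<in> ?h ` Y"
    then obtain y where "y \<in> Y" "j = ?h y" by blast
    then show "j \<in> {?h a..?h (a + int w)}" using Y assms(1) by (auto intro!: zdiv_mono1)
  qed
  then have "card Y \<le> nat (?h (a + int w) - ?h a + 1)"
    using card_image[OF inj] card_mono[of "{?h a..?h (a + int w)}" "?h ` Y"] by simp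
  moreover have "int l * (?h (a + int w) - ?h a + 1) \<le> int w + 2 * int l"
  proof -
    have "0 < int l" using assms(1) by simp
    have "?h (a + int w) * int l \<le> a + int w - x"
      using div_mult_mod_eq[of "a + int w - x" "int l"] pos_mod_sign[of "int l" "a + int w - x"] \<open>0 < int l\<close>
      by linarith
    moreover have "a - x < (?h a + 1) * int l"
      unfolding distrib_right
      using div_mult_mod_eq[of "a - x" "int l"] pos_mod_bound[of "int l" "a - x"] \<open>0 < int l\<close>
      by linarith
    ultimately show ?thesis by (simp add: algebra_simps)
  qed
  moreover have "?h a \<le> ?h (a + int w)" using assms(1) by (intro zdiv_mono1) auto
  ultimately have "int l * int (card Y) \<le> int w + 2 * int l"
    using mult_left_mono[of "int (card Y)" "?h (a + int w) - ?h a + 1" "int l"] by linarith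
  then show ?thesis by (simp flip: of_nat_mult)
qed

text \<open>
  A greedy (Vitali) selection: the largest interval \<open>[y - v y, y + v y]\<close> is disjoint from all those
  whose centres are at distance more than \<open>2 v y\<close>.
\<close>

lemma card_union_of_dense_intervals_ge:
  fixes Y :: "int set" and v :: "int \<Rightarrow> nat"
  assumes "finite A" "l \<ge> 1" "c \<ge> 0" and "finite Y"
    and inj: "inj_on (\<lambda>y. (y - x) div int l) Y"
    and v: "\<And>y. y \<in> Y \<Longrightarrow> l \<le> v y \<and> v y \<le> L"
    and dense: "\<And>y. y \<in> Y \<Longrightarrow> c * real (v y) powr (1/3) \<le> real (card (A \<inter> {y - int (v y)..y + int (v y)}))"
  shows "c * real L powr (- 2/3) * (real l * real (card Y)) \<le>
    6 * real (card (A \<inter> (\<Union>y\<in>Y. {y - int (v y)..y + int (v y)})))"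
  using \<open>finite Y\<close> inj v dense
proof (induction Y rule: finite_psubset_induct)
  case (psubset Y)
  let ?B = "\<lambda>y. {y - int (v y)..y + int (v y)}"
  show ?case
  proof (cases "Y = {}")
    case False
    then have "Max (v ` Y) \<in> v ` Y" using psubset.hyps by (intro Max_in) auto
    then obtain y where y: "y \<in> Y" "Max (v ` Y) = v y" by blast
    then have ymax: "v z \<le> v y" if "z \<in> Y" for z
      using that psubset.hyps by (metis Max_ge finite_imageI imageI)
    define w where "w = v y"
    have w: "l \<le> w" "w \<le> L" using psubset.prems(2)[OF y(1)] by (auto simp: w_def)
    then have "w \<ge> 1" "L \<ge> 1" using \<open>l \<ge> 1\<close> by auto
    \<comment> \<open>Only intervals centred in \<open>N\<close> can meet the largest one. Their
      centres lie in a window of length \<open>4 * w\<close>, so the separation by cells leaves at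
      most \<open>6 * w / l\<close> of them.\<close>
    define N where "N = {z \<in> Y. \<bar>z - y\<bar> \<le> 2 * int w}"
    define F where "F = Y - N"
    have "y \<in> N" using y by (simp add: N_def)
    then have "F \<subset> Y" using y by (auto simp: F_def)
    have NF: "card Y = card N + card F" "F \<subseteq> Y" "N \<subseteq> Y"
      using psubset.hyps by (auto simp: F_def N_def card_Diff_subset card_mono)
    have "N \<subseteq> {y - 2 * int w..(y - 2 * int w) + int (4 * w)}" by (auto simp: N_def)
    then have "l * card N \<le> 4 * w + 2 * l"
      using inj_on_subset[OF psubset.prems(1) \<open>N \<subseteq> Y\<close>] \<open>l \<ge> 1\<close>
      by (intro card_le_of_div_window[where a = "y - 2 * int w" and x = x])
    also have "\<dots> \<le> 6 * w" using w by simp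
    finally have "real (l * card N) \<le> real (6 * w)" by (simp only: of_nat_le_iff)
    then have N: "real l * real (card N) \<le> 6 * real w" by simp
    have "c * real L powr (- 2/3) * (real l * real (card N)) \<le> c * real L powr (- 2/3) * (6 * real w)"
      using N \<open>c \<ge> 0\<close> by (intro mult_left_mono) auto
    \<comment> \<open>The guaranteed number of points per unit length,
      \<open>c * w powr (- 2/3)\<close>, decreases in the radius, so the value at \<open>L\<close>
      serves for all radii.\<close>
    also have "\<dots> \<le> c * real w powr (- 2/3) * (6 * real w)"
      using w \<open>w \<ge> 1\<close> \<open>c \<ge> 0\<close> by (intro mult_left_mono mult_right_mono powr_mono2') auto
    also have "\<dots> = 6 * (c * real w powr (1/3))"
      using \<open>w \<ge> 1\<close> powr_add[of "real w" "- 2/3" 1] by simp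
    also have "\<dots> \<le> 6 * real (card (A \<inter> ?B y))"
      using psubset.prems(3)[OF y(1)] by (simp add: w_def)
    finally have near: "c * real L powr (- 2/3) * (real l * real (card N)) \<le> 6 * real (card (A \<inter> ?B y))" .
    have far: "c * real L powr (- 2/3) * (real l * real (card F)) \<le> 6 * real (card (A \<inter> (\<Union>z\<in>F. ?B z)))"
      using psubset.prems \<open>F \<subset> Y\<close> NF by (intro psubset.IH) (auto intro: inj_on_subset)
    have disj: "?B y \<inter> ?B z = {}" if "z \<in> F" for z
    proof -
      have "\<bar>z - y\<bar> > 2 * int w" "v z \<le> w" using that ymax by (auto simp: F_def N_def w_def)
      then show ?thesis by (auto simp: w_def)
    qed
    have "card (A \<inter> ?B y) + card (A \<inter> (\<Union>z\<in>F. ?B z)) = card ((A \<inter> ?B y) \<union> (A \<inter> (\<Union>z\<in>F. ?B z)))"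
      using disj \<open>finite A\<close> by (subst card_Un_disjoint) blast+
    also have "\<dots> \<le> card (A \<inter> (\<Union>z\<in>Y. ?B z))"
      using y NF \<open>finite A\<close> by (intro card_mono) auto
    finally have "card (A \<inter> ?B y) + card (A \<inter> (\<Union>z\<in>F. ?B z)) \<le> card (A \<inter> (\<Union>z\<in>Y. ?B z))" .
    then have "real (card (A \<inter> ?B y)) + real (card (A \<inter> (\<Union>z\<in>F. ?B z))) \<le> real (card (A \<inter> (\<Union>z\<in>Y. ?B z)))"
      by linarith
    moreover have "real (card Y) = real (card N) + real (card F)" using NF by simp
    ultimately show ?thesis using near far by (simp add: distrib_left)
  qed simp
qed

text \<open>Either some radius \<open>v y\<close> is at least the window length, and doubling it
  gives an interval around \<open>x\<close> with enough points; or all radii are smaller and the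
  covering argument adds up the intervals. The constant 24 is 6 from the covering, times 2 for
  having only half of the cells, times 2 for passing from radius \<open>L\<close> to
  \<open>2 * L\<close>.\<close>

lemma dense_around_of_occupied:
  fixes x :: int
  assumes A: "finite A" and lm: "l \<ge> 1" "m \<ge> 1" and "c \<ge> 0" and Y: "Y \<subseteq> {x..<x + int (m * l)}"
    and inj: "inj_on (\<lambda>y. (y - x) div int l) Y" and card: "m \<le> 2 * card Y"
    and dense: "\<And>y. y \<in> Y \<Longrightarrow> dense_around c l A y"
  shows "dense_around (c / 24) (m * l) A x"
proof -
  define L where "L = m * l"
  have "L \<ge> 1" using lm by (simp add: L_def Suc_le_eq)
  have two: "(2 * real u) powr (1/3) \<le> 2 * real u powr (1/3)" for u
  proof -
    have "(2 * real u) powr (1/3) = 2 powr (1/3) * real u powr (1/3)" by (simp add: powr_mult)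
    also have "\<dots> \<le> 2 powr 1 * real u powr (1/3)" by (intro mult_right_mono powr_mono) auto
    finally show ?thesis by simp
  qed
  obtain v where v: "\<And>y. y \<in> Y \<Longrightarrow> l \<le> v y"
    and dv: "\<And>y. y \<in> Y \<Longrightarrow> c * real (v y) powr (1/3) \<le> real (card (A \<inter> {y - int (v y)..y + int (v y)}))"
    using dense unfolding dense_around_def by metis
  have finY: "finite Y" using Y finite_subset by blast
  show ?thesis
  proof (cases "\<exists>y\<in>Y. v y \<ge> L")
    case True
    then obtain y where y: "y \<in> Y" "v y \<ge> L" by blast
    let ?u = "2 * v y"
    have "c / 24 * real ?u powr (1/3) \<le> c / 24 * (2 * real (v y) powr (1/3))"
      using two[of "v y"] \<open>c \<ge> 0\<close> by (intro mult_left_mono) auto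
    also have "\<dots> \<le> c * real (v y) powr (1/3)" using \<open>c \<ge> 0\<close> by simp
    also have "\<dots> \<le> real (card (A \<inter> {y - int (v y)..y + int (v y)}))" by (rule dv[OF y(1)])
    also have "card (A \<inter> {y - int (v y)..y + int (v y)}) \<le> card (A \<inter> {x - int ?u..x + int ?u})"
    proof -
      have "x \<le> y" "y < x + int L" using y Y by (auto simp: L_def)
      moreover have "int L \<le> int (v y)" using y by (simp only: of_nat_le_iff)
      ultimately show ?thesis using A by (intro card_mono) auto
    qed
    finally show ?thesis unfolding dense_around_def using y by (intro exI[of _ ?u]) (auto simp: L_def)
  next
    case False
    then have vL: "v y \<le> L" if "y \<in> Y" for y using that by force
    have "c * real L powr (- 2/3) * (real l * real (card Y)) \<le>
        6 * real (card (A \<inter> (\<Union>y\<in>Y. {y - int (v y)..y + int (v y)})))"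
      using A lm \<open>c \<ge> 0\<close> finY inj v dv vL by (intro card_union_of_dense_intervals_ge) auto
    also have "card (A \<inter> (\<Union>y\<in>Y. {y - int (v y)..y + int (v y)})) \<le> card (A \<inter> {x - int (2 * L)..x + int (2 * L)})"
    proof (rule card_mono)
      show "A \<inter> (\<Union>y\<in>Y. {y - int (v y)..y + int (v y)}) \<subseteq> A \<inter> {x - int (2 * L)..x + int (2 * L)}"
      proof safe
        fix a y assume "y \<in> Y" "a \<in> {y - int (v y)..y + int (v y)}"
        moreover have "x \<le> y" "y < x + int L" using \<open>y \<in> Y\<close> Y by (auto simp: L_def)
        ultimately show "a \<in> {x - int (2 * L)..x + int (2 * L)}" using vL[of y] by auto
      qed
    qed (use A in auto)
    finally have "c * real L powr (- 2/3) * (real l * real (card Y)) \<le>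
        6 * real (card (A \<inter> {x - int (2 * L)..x + int (2 * L)}))" by simp
    moreover have "c * real L powr (- 2/3) * (real L / 2) \<le> c * real L powr (- 2/3) * (real l * real (card Y))"
    proof -
      have "real l * real m \<le> real l * (2 * real (card Y))" using card by (intro mult_left_mono) auto
      then show ?thesis using \<open>c \<ge> 0\<close> by (intro mult_left_mono) (auto simp: L_def mult.commute)
    qed
    moreover have "real L powr (- 2/3) * real L = real L powr (1/3)"
      using \<open>L \<ge> 1\<close> powr_add[of "real L" "- 2/3" 1] by simp
    ultimately have "c * real L powr (1/3) \<le> 12 * real (card (A \<inter> {x - int (2 * L)..x + int (2 * L)}))"
      by (simp add: mult.assoc)
    moreover have "c * (2 * real L) powr (1/3) \<le> c * (2 * real L powr (1/3))"
      using two[of L] \<open>c \<ge> 0\<close> by (intro mult_left_mono) auto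
    ultimately have "c / 24 * real (2 * L) powr (1/3) \<le> real (card (A \<inter> {x - int (2 * L)..x + int (2 * L)}))"
      by simp
    then show ?thesis unfolding dense_around_def by (intro exI[of _ "2 * L"]) (auto simp: L_def)
  qed
qed

text \<open>
  The states in which scale \<open>m l\<close> around \<open>x\<close> still has to be filled; there the free sites attract
  the next particle with a good probability.
\<close>

definition starved :: "(int set \<Rightarrow> real) \<Rightarrow> real \<Rightarrow> real \<Rightarrow> nat \<Rightarrow> nat \<Rightarrow> int \<Rightarrow> int set \<Rightarrow> bool" where
  "starved cap P c l m x A \<longleftrightarrow>
     finite A \<and> cap A \<le> P \<and> \<not> dense_around (c / 24) (m * l) A x \<and>
     c * real l powr (1/3) \<le> real (card (A \<inter> {x - int (m * l)..x + int (m * l)})) \<and>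
     2 * card (occupied_cells l (m * l) A x) < m"

text \<open>Whole occupied cells are left out and not only points of \<open>A\<close>, so that a
  particle attached here always occupies a new cell.\<close>

definition free_sites :: "nat \<Rightarrow> nat \<Rightarrow> int \<Rightarrow> int set \<Rightarrow> int set" where
  "free_sites l m x A =
     {z \<in> {x..<x + int (m * l)}. (z - x) div int l \<notin> occupied_cells l (m * l) A x}"

text \<open>The time to reach scale \<open>m ^ k\<close>. One delay of the previous scale makes the
  surroundings of \<open>x\<close> dense, \<open>m\<close> blocks of length \<open>\<tau>\<close>
  fill the cells, and a second delay makes the new particles' surroundings dense.\<close>

fun delay :: "nat \<Rightarrow> nat \<Rightarrow> nat \<Rightarrow> nat" where
  "delay m \<tau> 0 = 0"
| "delay m \<tau> (Suc k) = 2 * delay m \<tau> k + m * \<tau>"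

lemma finite_occupied_cells: "finite A \<Longrightarrow> finite (occupied_cells l L A x)"
  by (simp add: occupied_cells_def)

lemma occupied_cells_mono: "A \<subseteq> B \<Longrightarrow> occupied_cells l L A x \<subseteq> occupied_cells l L B x"
  by (auto simp: occupied_cells_def)

lemma card_occupied_cells_mono:
  "A \<subseteq> B \<Longrightarrow> finite B \<Longrightarrow> card (occupied_cells l L A x) \<le> card (occupied_cells l L B x)"
  by (intro card_mono finite_occupied_cells occupied_cells_mono)

lemma card_occupied_cells_insert_free:
  assumes "finite A" "z \<in> free_sites l m x A"
  shows "card (occupied_cells l (m * l) (A \<union> {z}) x) = Suc (card (occupied_cells l (m * l) A x))"
proof -
  have "occupied_cells l (m * l) (A \<union> {z}) x = insert ((z - x) div int l) (occupied_cells l (m * l) A x)"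
    using assms(2) by (auto simp: occupied_cells_def free_sites_def)
  then show ?thesis
    using assms by (simp add: free_sites_def finite_occupied_cells)
qed

text \<open>The induction over scales for a fixed path. The hypothesis \<open>landing\<close> is
  what probability has to supply: no block of length \<open>\<tau>\<close> consists only of starved
  states followed by particles off the free sites.\<close>

lemma growth_of_dense_scale:
  fixes B :: "nat \<Rightarrow> int set"
  assumes "m \<ge> 1" "c \<ge> 0" "c \<le> 1"
    and fin: "\<And>s. 1 \<le> s \<Longrightarrow> s \<le> n \<Longrightarrow> finite (B s)"
    and mono: "\<And>s t. 1 \<le> s \<Longrightarrow> s \<le> t \<Longrightarrow> t \<le> n \<Longrightarrow> B s \<subseteq> B t"
    and cap: "\<And>s. 1 \<le> s \<Longrightarrow> s \<le> n \<Longrightarrow> cap (B s) \<le> P"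
    and landing: "\<And>k t x. k < J \<Longrightarrow> 1 \<le> t \<Longrightarrow> t + \<tau> \<le> n \<Longrightarrow> x \<in> B t \<Longrightarrow>
      \<exists>s\<in>{t..<t + \<tau>}. starved cap P (c / 24 ^ k) (m ^ k) m x (B s) \<longrightarrow>
         (\<exists>z\<in>free_sites (m ^ k) m x (B s). B (Suc s) = B s \<union> {z})"
    and "k \<le> J" "1 \<le> t" "t + delay m \<tau> k \<le> n" "x \<in> B t"
  shows "dense_around (c / 24 ^ k) (m ^ k) (B (t + delay m \<tau> k)) x"
  using assms(8-)
proof (induction k arbitrary: t x)
  case 0
  have "real (card {x}) \<le> real (card (B t \<inter> {x - int 1..x + int 1}))"
    using 0 fin[of t] by (intro of_nat_mono card_mono) auto
  then show ?case using \<open>c \<le> 1\<close> unfolding dense_around_def by (intro exI[of _ 1]) auto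
next
  case (Suc k)
  define l where "l = m ^ k"
  define L where "L = m * l"
  define T where "T = delay m \<tau> k"
  define c1 where "c1 = c / 24 ^ k"
  define t0 where "t0 = t + T"
  define t1 where "t1 = t0 + m * \<tau>"
  have end_time: "t + delay m \<tau> (Suc k) = t1 + T" by (simp add: t1_def t0_def T_def)
  have l: "l \<ge> 1" using \<open>m \<ge> 1\<close> by (simp add: l_def)
  have "c1 \<ge> 0" using \<open>c \<ge> 0\<close> by (simp add: c1_def)
  have n: "t1 + T \<le> n" using Suc.prems(3) end_time by simp
  have IH: "dense_around c1 l (B (s + T)) y" if "1 \<le> s" "s + T \<le> n" "y \<in> B s" for s y
    unfolding c1_def l_def T_def using Suc.prems(1) that by (intro Suc.IH) (auto simp: T_def)
  have c2: "c / 24 ^ Suc k = c1 / 24" by (simp add: c1_def)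
  have L': "m ^ Suc k = m * l" by (simp add: l_def)
  have t: "1 \<le> t" "t \<le> t0" "t0 \<le> t1" using Suc.prems by (auto simp: t0_def t1_def)
  show ?case
  proof (rule ccontr)
    assume "\<not> ?thesis"
    then have nd: "\<not> dense_around (c1 / 24) (m * l) (B (t1 + T)) x"
      unfolding end_time c2 L' .
    \<comment> \<open>Density passes to larger sets, so its failure at the end time excludes it at
      all earlier times; the window stays sparse while its cells are being filled.\<close>
    have nds: "\<not> dense_around (c1 / 24) (m * l) (B s) x" if "1 \<le> s" "s \<le> t1 + T" for s
      using nd mono[of s "t1 + T"] fin[of "t1 + T"] n that dense_around_mono[of "c1 / 24" "m * l" "B s" x "B (t1 + T)" "c1 / 24" "m * l"]
      by auto
    have "dense_around c1 l (B t0) x"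
      unfolding t0_def using Suc.prems n by (intro IH) (auto simp: t1_def t0_def)
    then obtain v where v: "v \<ge> l" "c1 * real v powr (1/3) \<le> real (card (B t0 \<inter> {x - int v..x + int v}))"
      by (auto simp: dense_around_def)
    \<comment> \<open>A larger radius would already mean density from scale \<open>m * l\<close> on.
      Hence the points found around \<open>x\<close> are close enough to attract particles into the
      window.\<close>
    have "v < m * l"
    proof (rule ccontr)
      assume "\<not> v < m * l"
      moreover have "c1 / 24 * real v powr (1/3) \<le> c1 * real v powr (1/3)"
        using \<open>c1 \<ge> 0\<close> by (intro mult_right_mono) auto
      ultimately have "dense_around (c1 / 24) (m * l) (B t0) x"
        unfolding dense_around_def using v by (intro exI[of _ v]) auto
      then show False using nds[of t0] t by auto
    qed
    have near: "c1 * real l powr (1/3) \<le> real (card (B s \<inter> {x - int (m * l)..x + int (m * l)}))"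
      if "t0 \<le> s" "s \<le> t1" for s
    proof -
      have "c1 * real l powr (1/3) \<le> c1 * real v powr (1/3)"
        using v \<open>c1 \<ge> 0\<close> by (intro mult_left_mono powr_mono2) auto
      also note v(2)
      also have "card (B t0 \<inter> {x - int v..x + int v}) \<le> card (B s \<inter> {x - int (m * l)..x + int (m * l)})"
      proof (rule card_mono)
        show "finite (B s \<inter> {x - int (m * l)..x + int (m * l)})" by simp
        have "int v \<le> int (m * l)" using \<open>v < m * l\<close> by (simp only: of_nat_le_iff)
        then show "B t0 \<inter> {x - int v..x + int v} \<subseteq> B s \<inter> {x - int (m * l)..x + int (m * l)}"
          using mono[of t0 s] t that n by auto
      qed
      finally show ?thesis by simp
    qed
    let ?occ = "\<lambda>s. card (occupied_cells l (m * l) (B s) x)"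
    have occ_mono: "?occ s \<le> ?occ s'" if "1 \<le> s" "s \<le> s'" "s' \<le> t1" for s s'
      using that n by (intro card_occupied_cells_mono mono fin) auto
    \<comment> \<open>Each block of length \<open>\<tau>\<close> adds an occupied cell, unless half
      of the cells are occupied already.\<close>
    have "i \<le> ?occ (t0 + i * \<tau>) \<or> m \<le> 2 * ?occ (t0 + i * \<tau>)" if "i \<le> m" for i
      using that
    proof (induction i)
      case (Suc i)
      let ?s = "t0 + i * \<tau>"
      have s_end: "?s + \<tau> \<le> t1" using mult_le_mono1[OF Suc.prems, of \<tau>] by (simp add: t1_def)
      have step: "?occ s \<le> ?occ (?s + \<tau>)" if "?s \<le> s" "s \<le> ?s + \<tau>" for s
        using that t s_end by (intro occ_mono) auto
      show ?case
      proof (cases "m \<le> 2 * ?occ (?s + \<tau>)")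
        case False
        have i: "i \<le> ?occ ?s" using Suc False step[of ?s] by auto
        have "x \<in> B ?s" using Suc.prems \<open>x \<in> B t\<close> mono[of t ?s] t s_end n by auto
        then have "\<exists>s\<in>{?s..<?s + \<tau>}. starved cap P c1 l m x (B s) \<longrightarrow>
            (\<exists>z\<in>free_sites l m x (B s). B (Suc s) = B s \<union> {z})"
          unfolding c1_def l_def using Suc_le_lessD[OF \<open>Suc k \<le> J\<close>] t s_end n
          by (intro landing) auto
        then obtain s where s: "s \<in> {?s..<?s + \<tau>}" and
          "starved cap P c1 l m x (B s) \<longrightarrow> (\<exists>z\<in>free_sites l m x (B s). B (Suc s) = B s \<union> {z})"
          by blast
        moreover have "starved cap P c1 l m x (B s)"
          unfolding starved_def
          using s t s_end n fin[of s] cap[of s] nds[of s] near[of s] False step[of s] by auto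
        ultimately obtain z where "z \<in> free_sites l m x (B s)" "B (Suc s) = B s \<union> {z}" by blast
        then have "?occ (Suc s) = Suc (?occ s)"
          using card_occupied_cells_insert_free[of "B s" z l m x] fin[of s] s t s_end n by auto
        moreover have "?occ ?s \<le> ?occ s" using s t s_end by (intro occ_mono) auto
        moreover have "?occ (Suc s) \<le> ?occ (?s + \<tau>)" using s by (intro step) auto
        ultimately have "Suc i \<le> ?occ (?s + \<tau>)" using i by linarith
        then show ?thesis by (simp add: add_ac)
      qed (simp add: add_ac)
    qed simp
    from this[of m] have occ: "m \<le> 2 * ?occ t1" by (auto simp: t1_def)
    let ?h = "\<lambda>y. (y - x) div int l"
    let ?C = "B t1 \<inter> {x..<x + int (m * l)}"
    \<comment> \<open>One particle is selected per occupied cell. All of them are present at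
      \<open>t1\<close>, so a second delay \<open>T\<close> makes each of them dense from scale
      \<open>l\<close> on.\<close>
    define g where "g = (\<lambda>j. SOME y. y \<in> ?C \<and> ?h y = j)"
    have g: "g j \<in> ?C" "?h (g j) = j" if "j \<in> occupied_cells l (m * l) (B t1) x" for j
    proof -
      have "\<exists>y. y \<in> ?C \<and> ?h y = j" using that by (auto simp: occupied_cells_def)
      from someI_ex[OF this] show "g j \<in> ?C" "?h (g j) = j" unfolding g_def by blast+
    qed
    define Y where "Y = g ` occupied_cells l (m * l) (B t1) x"
    have "dense_around (c1 / 24) (m * l) (B (t1 + T)) x"
    proof (rule dense_around_of_occupied)
      show "finite (B (t1 + T))" using fin[of "t1 + T"] n t by auto
      show "Y \<subseteq> {x..<x + int (m * l)}" using g by (auto simp: Y_def)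
      show "inj_on ?h Y" using g by (auto simp: Y_def inj_on_def)
      have "inj_on g (occupied_cells l (m * l) (B t1) x)" using g by (metis inj_onI)
      then show "m \<le> 2 * card Y" using occ by (simp add: Y_def card_image)
      show "dense_around c1 l (B (t1 + T)) y" if "y \<in> Y" for y
        using that g n t by (intro IH) (auto simp: Y_def)
    qed (use l \<open>m \<ge> 1\<close> \<open>c1 \<ge> 0\<close> in auto)
    then show False using nd by contradiction
  qed
qed

text \<open>With \<open>m * \<tau>\<close> added, the recursion is exact doubling.\<close>

lemma delay_le: "m * \<tau> + delay m \<tau> k \<le> 2 ^ k * (m * \<tau>)"
proof (induction k)
  case (Suc k)
  then have "2 * (m * \<tau> + delay m \<tau> k) \<le> 2 * (2 ^ k * (m * \<tau>))" by (rule mult_le_mono2)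
  then show ?case by (simp add: algebra_simps)
qed simp

section \<open>Aggregation as a Markov chain\<close>

text \<open>A bound on the conditional probability given each value of a discrete \<open>H\<close>
  passes to the whole event; this takes the place of conditional expectations.\<close>

lemma (in finite_measure) measure_le_of_countable_partition:
  assumes I: "countable I" and meas: "\<And>h. h \<in> I \<Longrightarrow> {\<omega> \<in> space M. H \<omega> = h} \<in> sets M"
    and cover: "\<And>\<omega>. \<omega> \<in> E \<Longrightarrow> H \<omega> \<in> I" and E: "E \<in> sets M" and F: "F \<in> sets M"
    and "0 \<le> r"
    and le: "\<And>h. h \<in> I \<Longrightarrow> measure M ({\<omega> \<in> space M. H \<omega> = h} \<inter> E \<inter> F) \<le> r * measure M ({\<omega> \<in> space M. H \<omega> = h} \<inter> E)"
  shows "measure M (E \<inter> F) \<le> r * measure M E"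
proof -
  let ?P = "\<lambda>h. {\<omega> \<in> space M. H \<omega> = h}"
  have disj: "disjoint_family_on (\<lambda>h. ?P h \<inter> E) I" "disjoint_family_on (\<lambda>h. ?P h \<inter> E \<inter> F) I"
    by (auto simp: disjoint_family_on_def)
  have UN: "E = (\<Union>h\<in>I. ?P h \<inter> E)" "E \<inter> F = (\<Union>h\<in>I. ?P h \<inter> E \<inter> F)"
    using cover sets.sets_into_space[OF E] by auto
  have "emeasure M (E \<inter> F) = (\<integral>\<^sup>+ h. emeasure M (?P h \<inter> E \<inter> F) \<partial>count_space I)"
    by (subst UN(2), rule emeasure_UN_countable[OF _ I disj(2)]) (intro sets.Int meas E F)
  also have "\<dots> \<le> (\<integral>\<^sup>+ h. ennreal r * emeasure M (?P h \<inter> E) \<partial>count_space I)"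
    using le \<open>0 \<le> r\<close>
    by (intro nn_integral_mono) (simp add: emeasure_eq_measure ennreal_mult'[symmetric])
  also have "\<dots> = ennreal r * (\<integral>\<^sup>+ h. emeasure M (?P h \<inter> E) \<partial>count_space I)"
    by (rule nn_integral_cmult) simp
  also have "(\<integral>\<^sup>+ h. emeasure M (?P h \<inter> E) \<partial>count_space I) = emeasure M (\<Union>h\<in>I. ?P h \<inter> E)"
    by (rule emeasure_UN_countable[OF _ I disj(1), symmetric]) (intro sets.Int meas E)
  also have "\<dots> = emeasure M E" using UN(1) by simp
  finally show ?thesis
    using \<open>0 \<le> r\<close> by (simp add: emeasure_eq_measure ennreal_mult'[symmetric])
qed

locale dla_walk = stable_walk +
  fixes M :: "'w measure" and A :: "nat \<Rightarrow> 'w \<Rightarrow> int set"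
  assumes dla: "dla_process p M A"
begin

sublocale prob_space M
  using dla by (simp add: dla_process_def markov_chain_def)

text \<open>The restriction puts the histories into a countable set, a \<open>Pi\<^sub>E\<close>
  over finitely many indices.\<close>

definition hist :: "nat \<Rightarrow> 'w \<Rightarrow> nat \<Rightarrow> int set" where
  "hist n \<omega> = restrict (\<lambda>i. A i \<omega>) {1..n}"

lemma A_measurable: "n \<ge> 1 \<Longrightarrow> A n \<in> M \<rightarrow>\<^sub>M count_space {B. finite B}"
  using dla by (simp add: dla_process_def markov_chain_def)

lemma finite_A: "n \<ge> 1 \<Longrightarrow> \<omega> \<in> space M \<Longrightarrow> finite (A n \<omega>)"
  using measurable_space[OF A_measurable] by simp

lemma A_eq_sets: "n \<ge> 1 \<Longrightarrow> {\<omega> \<in> space M. A n \<omega> = B} \<in> sets M"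
proof (cases "finite B")
  case True
  assume "n \<ge> 1"
  then show ?thesis
    using measurable_sets[OF A_measurable, of n "{B}"] True by (simp add: vimage_def Int_def conj_commute)
next
  case False
  assume "n \<ge> 1"
  then have "{\<omega> \<in> space M. A n \<omega> = B} = {}" using False finite_A by auto
  then show ?thesis by (metis sets.empty_sets)
qed

lemma countable_histories: "countable (Pi\<^sub>E {1..n :: nat} (\<lambda>_. {B :: int set. finite B}))"
  by (intro countable_PiE) (auto intro: countable_Collect_finite)

lemma hist_in: "\<omega> \<in> space M \<Longrightarrow> hist n \<omega> \<in> Pi\<^sub>E {1..n} (\<lambda>_. {B. finite B})"
  by (auto simp: hist_def finite_A)

lemma hist_eq_iff:
  "h \<in> Pi\<^sub>E {1..n} (\<lambda>_. {B. finite B}) \<Longrightarrow> hist n \<omega> = h \<longleftrightarrow> (\<forall>i\<in>{1..n}. A i \<omega> = h i)"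
  by (auto simp: hist_def fun_eq_iff PiE_iff extensional_def restrict_def)

lemma hist_eq_sets:
  assumes "h \<in> Pi\<^sub>E {1..n} (\<lambda>_. {B. finite B})"
  shows "{\<omega> \<in> space M. hist n \<omega> = h} \<in> sets M"
  unfolding hist_eq_iff[OF assms] by (intro sets.sets_Collect_finite_All A_eq_sets) auto

text \<open>An arbitrary predicate is allowed because the event is a countable union of atoms.
  Events of missed landings are measurable by writing them through \<open>hist\<close>.\<close>

lemma sets_hist: "{\<omega> \<in> space M. Q (hist n \<omega>)} \<in> sets M"
proof -
  let ?I = "{h \<in> Pi\<^sub>E {1..n} (\<lambda>_. {B. finite B}). Q h}"
  have "{\<omega> \<in> space M. Q (hist n \<omega>)} = (\<Union>h\<in>?I. {\<omega> \<in> space M. hist n \<omega> = h})"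
    using hist_in by auto
  also have "\<dots> \<in> sets M"
    by (rule sets.countable_UN') (use hist_eq_sets countable_histories in auto)
  finally show ?thesis .
qed

text \<open>In product form the rule also covers conditioning events of probability 0. The event
  \<open>E\<close> fixes either the present state or the whole history; the Markov property reduces
  the second case to the first.\<close>

lemma transition_prob:
  assumes "n \<ge> 1" "x \<notin> B"
    and ev: "E = {\<omega> \<in> space M. A n \<omega> = B} \<or>
      (\<exists>h. h n = B \<and> E = {\<omega> \<in> space M. \<forall>i\<in>{1..n}. A i \<omega> = h i})"
  shows "measure M (E \<inter> {\<omega> \<in> space M. A (Suc n) \<omega> = B \<union> {x}}) =
    measure M E * ((\<Sum>a\<in>B. step_prob p x a * escape_prob p B x) / capacity p B)"
proof (cases "measure M E = 0")
  case True
  moreover have "E \<in> sets M"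
    using ev \<open>n \<ge> 1\<close> A_eq_sets by (auto intro!: sets.sets_Collect_finite_All)
  ultimately show ?thesis
    using finite_measure_mono[of "E \<inter> {\<omega> \<in> space M. A (Suc n) \<omega> = B \<union> {x}}" E]
    by (simp add: measure_le_0_iff)
next
  case False
  then have pos: "measure M E > 0" by (simp add: zero_less_measure_iff)
  let ?t = "(\<Sum>a\<in>B. step_prob p x a * escape_prob p B x) / capacity p B"
  have "E \<subseteq> {\<omega> \<in> space M. A n \<omega> = B}" using ev \<open>n \<ge> 1\<close> by auto
  then have "measure M E \<le> measure M {\<omega> \<in> space M. A n \<omega> = B}"
    by (intro finite_measure_mono A_eq_sets \<open>n \<ge> 1\<close>)
  then have posB: "\<P>(\<omega> in M. A n \<omega> = B) > 0" using pos by simp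
  have tr: "\<P>(\<omega> in M. A (Suc n) \<omega> = B \<union> {x} \<bar> A n \<omega> = B) = ?t"
    using dla \<open>n \<ge> 1\<close> \<open>x \<notin> B\<close> posB unfolding dla_process_def sum_divide_distrib by blast
  have "measure M (E \<inter> {\<omega> \<in> space M. A (Suc n) \<omega> = B \<union> {x}}) / measure M E = ?t"
    using ev
  proof
    assume E: "E = {\<omega> \<in> space M. A n \<omega> = B}"
    have "E \<inter> {\<omega> \<in> space M. A (Suc n) \<omega> = B \<union> {x}} = {\<omega> \<in> space M. A (Suc n) \<omega> = B \<union> {x} \<and> A n \<omega> = B}"
      using E by auto
    then show ?thesis using tr E by (simp add: cond_prob_def)
  next
    assume "\<exists>h. h n = B \<and> E = {\<omega> \<in> space M. \<forall>i\<in>{1..n}. A i \<omega> = h i}"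
    then obtain h where h: "h n = B" "E = {\<omega> \<in> space M. \<forall>i\<in>{1..n}. A i \<omega> = h i}" by blast
    have "\<P>(\<omega> in M. A (Suc n) \<omega> = B \<union> {x} \<bar> \<forall>i\<in>{1..n}. A i \<omega> = h i) =
        \<P>(\<omega> in M. A (Suc n) \<omega> = B \<union> {x} \<bar> A n \<omega> = h n)"
      using dla \<open>n \<ge> 1\<close> pos h(2) unfolding dla_process_def markov_chain_def by blast
    moreover have "E \<inter> {\<omega> \<in> space M. A (Suc n) \<omega> = B \<union> {x}} =
        {\<omega> \<in> space M. A (Suc n) \<omega> = B \<union> {x} \<and> (\<forall>i\<in>{1..n}. A i \<omega> = h i)}"
      using h by auto
    ultimately show ?thesis using tr h by (simp add: cond_prob_def)
  qed
  then show ?thesis using pos by (simp add: field_simps)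
qed

text \<open>By \<open>nn_integral_attachment\<close>, adding one new point already exhausts the
  probability of each nonempty state, so any other transition is a null event; there are countably
  many states.\<close>

lemma AE_growth_step:
  assumes n: "n \<ge> 1"
  shows "AE \<omega> in M. A n \<omega> \<noteq> {} \<longrightarrow> (\<exists>x. x \<notin> A n \<omega> \<and> A (Suc n) \<omega> = A n \<omega> \<union> {x})"
proof -
  have "AE \<omega> in M. A n \<omega> = B \<longrightarrow> (\<exists>x. x \<notin> B \<and> A (Suc n) \<omega> = B \<union> {x})"
    if B: "finite B" "B \<noteq> {}" for B
  proof -
    let ?E = "{\<omega> \<in> space M. A n \<omega> = B}"
    let ?G = "\<lambda>x. ?E \<inter> {\<omega> \<in> space M. A (Suc n) \<omega> = B \<union> {x}}"
    let ?t = "\<lambda>x. \<Sum>a\<in>B. step_prob p x a * escape_prob p B x"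
    have G: "?G x \<in> sets M" for x by (intro sets.Int A_eq_sets n) auto
    have cap: "capacity p B > 0" by (rule capacity_pos[OF B])
    have t: "?t x \<ge> 0" for x
      by (auto intro!: sum_nonneg simp: step_prob_eq_pmf escape_prob_bounds)
    have "emeasure M (\<Union>x\<in>- B. ?G x) = (\<integral>\<^sup>+ x. emeasure M (?G x) \<partial>count_space (- B))"
    proof (rule emeasure_UN_countable)
      show "disjoint_family_on ?G (- B)" by (auto simp: disjoint_family_on_def)
    qed (use G in auto)
    also have "\<dots> = (\<integral>\<^sup>+ x. ennreal (measure M ?E / capacity p B) * ennreal (?t x) \<partial>count_space (- B))"
    proof (rule nn_integral_cong)
      fix x assume "x \<in> space (count_space (- B))"
      then have "measure M (?G x) = measure M ?E * (?t x / capacity p B)"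
        by (intro transition_prob n) auto
      then show "emeasure M (?G x) = ennreal (measure M ?E / capacity p B) * ennreal (?t x)"
        using t[of x] cap by (simp add: emeasure_eq_measure ennreal_mult'[symmetric])
    qed
    also have "\<dots> = ennreal (measure M ?E / capacity p B) * (\<integral>\<^sup>+ x. ennreal (?t x) \<partial>count_space (- B))"
      by (rule nn_integral_cmult) simp
    also have "(\<integral>\<^sup>+ x. ennreal (?t x) \<partial>count_space (- B)) =
        (\<integral>\<^sup>+ x. ennreal (indicator (- B) x * ?t x) \<partial>count_space UNIV)"
      by (subst nn_integral_count_space_indicator)
         (auto intro!: nn_integral_cong simp: indicator_def)
    also have "\<dots> = ennreal (capacity p B)" by (rule nn_integral_attachment[OF sym B(1)])
    also have "ennreal (measure M ?E / capacity p B) * ennreal (capacity p B) = emeasure M ?E"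
      using cap by (simp add: emeasure_eq_measure ennreal_mult'[symmetric])
    finally have eq: "emeasure M (\<Union>x\<in>- B. ?G x) = emeasure M ?E" .
    have meas: "(\<Union>x\<in>- B. ?G x) \<in> sets M" using G by (intro sets.countable_UN') auto
    have "emeasure M (?E - (\<Union>x\<in>- B. ?G x)) = 0"
      using eq meas A_eq_sets[OF n] by (subst emeasure_Diff) auto
    then have "AE \<omega> in M. \<omega> \<notin> ?E - (\<Union>x\<in>- B. ?G x)"
      using meas A_eq_sets[OF n] by (intro AE_not_in) (auto simp: null_sets_def)
    then show ?thesis
      by (rule AE_mp) (auto intro!: AE_I2)
  qed
  then have "AE \<omega> in M. \<forall>B\<in>{B. finite B \<and> B \<noteq> {}}.
      A n \<omega> = B \<longrightarrow> (\<exists>x. x \<notin> B \<and> A (Suc n) \<omega> = B \<union> {x})"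
    by (subst AE_ball_countable) (auto intro: countable_subset[OF _ countable_Collect_finite])
  then show ?thesis
    by (rule AE_mp) (use finite_A[OF n] in \<open>auto intro!: AE_I2\<close>)
qed

text \<open>The paths to which the deterministic argument is applied; almost every path is of this
  form.\<close>

definition growing :: "(nat \<Rightarrow> int set) \<Rightarrow> bool" where
  "growing B \<longleftrightarrow> B 1 = {0} \<and> (\<forall>n\<ge>1. \<exists>x. x \<notin> B n \<and> B (Suc n) = B n \<union> {x})"

lemma AE_growing: "AE \<omega> in M. growing (\<lambda>n. A n \<omega>)"
proof -
  have "AE \<omega> in M. A 1 \<omega> = {0}" using dla by (simp add: dla_process_def)
  moreover have "AE \<omega> in M. \<forall>n\<ge>1. A n \<omega> \<noteq> {} \<longrightarrow> (\<exists>x. x \<notin> A n \<omega> \<and> A (Suc n) \<omega> = A n \<omega> \<union> {x})"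
    unfolding AE_all_countable
  proof
    fix n
    show "AE \<omega> in M. 1 \<le> n \<longrightarrow> A n \<omega> \<noteq> {} \<longrightarrow> (\<exists>x. x \<notin> A n \<omega> \<and> A (Suc n) \<omega> = A n \<omega> \<union> {x})"
      using AE_growth_step[of n] by (cases "1 \<le> n") simp_all
  qed
  ultimately show ?thesis
  proof eventually_elim
    case (elim \<omega>)
    have "A n \<omega> \<noteq> {}" if "n \<ge> 1" for n
      using that
    proof (induction n rule: dec_induct)
      case (step n)
      then show ?case using elim(2)[rule_format, of n] by auto
    qed (use elim(1) in simp)
    then show ?case using elim by (auto simp: growing_def)
  qed
qed

lemma growing_mono: "growing B \<Longrightarrow> 1 \<le> s \<Longrightarrow> s \<le> t \<Longrightarrow> B s \<subseteq> B t"
proof -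
  assume g: "growing B" and "1 \<le> s"
  assume "s \<le> t"
  then show ?thesis
  proof (induction t rule: dec_induct)
    case (step t)
    obtain x where "B (Suc t) = B t \<union> {x}"
      using g step \<open>1 \<le> s\<close> unfolding growing_def by (meson le_trans)
    then show ?case using step by auto
  qed simp
qed

lemma growing_card: "growing B \<Longrightarrow> 1 \<le> n \<Longrightarrow> finite (B n) \<and> card (B n) = n"
proof -
  assume g: "growing B"
  assume "1 \<le> n"
  then show ?thesis
  proof (induction n rule: dec_induct)
    case (step n)
    obtain x where "x \<notin> B n" "B (Suc n) = B n \<union> {x}"
      using g step unfolding growing_def by auto
    then show ?case using step by simp
  qed (use g in \<open>simp add: growing_def\<close>)
qed

section \<open>Blocks of missed landings\<close>

text \<open>A time at which \<open>U\<close> fails is not a miss. So in a run of misses every state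
  lies in \<open>U\<close>, and every step had a guaranteed chance to hit its target
  \<open>W\<close>.\<close>

definition miss :: "(int set \<Rightarrow> bool) \<Rightarrow> (int set \<Rightarrow> int set) \<Rightarrow> (nat \<Rightarrow> int set) \<Rightarrow> nat \<Rightarrow> bool" where
  "miss U W B s \<longleftrightarrow> U (B s) \<and> \<not> (\<exists>z\<in>W (B s). B (Suc s) = B s \<union> {z})"

text \<open>On each atom of the history, landings on different sites of \<open>W B\<close> are
  disjoint events whose conditional probabilities add up to at least \<open>q\<close>, and a miss
  excludes all of them.\<close>

lemma prob_miss_step_le:
  assumes n: "n \<ge> 1"
    and W: "\<And>B. U B \<Longrightarrow> finite (W B) \<and> W B \<inter> B = {} \<and>
      q \<le> (\<Sum>z\<in>W B. (\<Sum>a\<in>B. step_prob p z a * escape_prob p B z) / capacity p B)"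
    and q: "q \<le> 1"
    and E: "\<And>\<omega>. \<omega> \<in> space M \<Longrightarrow> Q (hist n \<omega>) \<Longrightarrow> U (A n \<omega>)"
  shows "measure M {\<omega> \<in> space M. Q (hist n \<omega>) \<and> miss U W (\<lambda>s. A s \<omega>) n} \<le>
    (1 - q) * measure M {\<omega> \<in> space M. Q (hist n \<omega>)}"
proof -
  let ?E = "{\<omega> \<in> space M. Q (hist n \<omega>)}"
  let ?F = "{\<omega> \<in> space M. miss U W (\<lambda>s. A s \<omega>) n}"
  let ?I = "Pi\<^sub>E {1..n} (\<lambda>_. {B :: int set. finite B})"
  have F: "?F \<in> sets M"
    using sets_hist[of "\<lambda>h. miss U W h n" "Suc n"] n by (simp add: hist_def miss_def)
  have "measure M (?E \<inter> ?F) \<le> (1 - q) * measure M ?E"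
  proof (rule measure_le_of_countable_partition[where H = "hist n" and I = ?I])
    fix h assume h: "h \<in> ?I"
    let ?P = "{\<omega> \<in> space M. hist n \<omega> = h}"
    show "measure M (?P \<inter> ?E \<inter> ?F) \<le> (1 - q) * measure M (?P \<inter> ?E)"
    proof (cases "Q h \<and> ?P \<noteq> {}")
      case False
      then have "?P \<inter> ?E = {}" by auto
      then show ?thesis by (metis Int_empty_left measure_empty mult_zero_right order_refl)
    next
      case True
      define B where "B = h n"
      have P: "?P = {\<omega> \<in> space M. \<forall>i\<in>{1..n}. A i \<omega> = h i}" using hist_eq_iff[OF h] by auto
      have AB: "A n \<omega> = B" if "\<omega> \<in> ?P" for \<omega> using that n unfolding P B_def by auto
      \<comment> \<open>The hypothesis gives \<open>U\<close> only at sample points, which is why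
        empty atoms are treated separately.\<close>
      obtain \<omega> where "\<omega> \<in> ?P" using True by blast
      then have "U B" using E[of \<omega>] AB[of \<omega>] True by auto
      note WB = W[OF this]
      let ?G = "\<lambda>z. ?P \<inter> {\<omega> \<in> space M. A (Suc n) \<omega> = B \<union> {z}}"
      have G: "?G z \<in> sets M" for z by (intro sets.Int hist_eq_sets[OF h] A_eq_sets) auto
      have "measure M (\<Union>z\<in>W B. ?G z) = (\<Sum>z\<in>W B. measure M (?G z))"
      proof (rule finite_measure_finite_Union)
        show "disjoint_family_on ?G (W B)" using WB by (auto simp: disjoint_family_on_def)
      qed (use G WB in auto)
      also have "\<dots> = (\<Sum>z\<in>W B. measure M ?P * ((\<Sum>a\<in>B. step_prob p z a * escape_prob p B z) / capacity p B))"
        using WB n P by (intro sum.cong transition_prob refl) (auto simp: B_def)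
      also have "\<dots> = measure M ?P * (\<Sum>z\<in>W B. (\<Sum>a\<in>B. step_prob p z a * escape_prob p B z) / capacity p B)"
        by (simp add: sum_distrib_left)
      also have "\<dots> \<ge> measure M ?P * q" using WB by (intro mult_left_mono) auto
      finally have hit: "measure M ?P * q \<le> measure M (\<Union>z\<in>W B. ?G z)" .
      have "?P \<inter> ?E \<inter> ?F \<subseteq> ?P - (\<Union>z\<in>W B. ?G z)" using AB by (auto simp: miss_def)
      moreover have meas: "(\<Union>z\<in>W B. ?G z) \<in> sets M" using G WB by (intro sets.finite_UN) auto
      ultimately have "measure M (?P \<inter> ?E \<inter> ?F) \<le> measure M (?P - (\<Union>z\<in>W B. ?G z))"
        by (intro finite_measure_mono sets.Diff hist_eq_sets[OF h])
      also have "\<dots> = measure M ?P - measure M (\<Union>z\<in>W B. ?G z)"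
        using meas by (intro finite_measure_Diff hist_eq_sets[OF h]) auto
      also have "\<dots> \<le> (1 - q) * measure M ?P" using hit by (simp add: algebra_simps)
      finally have "measure M (?P \<inter> ?E \<inter> ?F) \<le> (1 - q) * measure M ?P" .
      moreover have "?P \<inter> ?E = ?P" using True by auto
      ultimately show ?thesis by simp
    qed
    show "{\<omega> \<in> space M. hist n \<omega> = h} \<in> sets M" by (rule hist_eq_sets[OF h])
  next
    show "?E \<in> sets M" by (rule sets_hist)
    show "hist n \<omega> \<in> ?I" if "\<omega> \<in> ?E" for \<omega> using that hist_in by blast
  qed (use q F countable_histories in auto)
  moreover have "?E \<inter> ?F = {\<omega> \<in> space M. Q (hist n \<omega>) \<and> miss U W (\<lambda>s. A s \<omega>) n}" by auto
  ultimately show ?thesis by simp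
qed

lemma prob_miss_block_le:
  assumes t: "t \<ge> 1"
    and W: "\<And>B. U B \<Longrightarrow> finite (W B) \<and> W B \<inter> B = {} \<and>
      q \<le> (\<Sum>z\<in>W B. (\<Sum>a\<in>B. step_prob p z a * escape_prob p B z) / capacity p B)"
    and q: "q \<le> 1"
  shows "measure M {\<omega> \<in> space M. A t \<omega> = B \<and> (\<forall>s\<in>{t..<t + j}. miss U W (\<lambda>s. A s \<omega>) s)} \<le>
    (1 - q) ^ j * measure M {\<omega> \<in> space M. A t \<omega> = B}"
proof (induction j)
  case (Suc j)
  define Q where "Q = (\<lambda>h. h t = B \<and> (\<forall>s\<in>{t..<t + j}. miss U W h s))"
  \<comment> \<open>A miss at time \<open>s\<close> involves the state at time \<open>s + 1\<close>,
    so the misses before \<open>t + j\<close> are determined by the history up to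
    \<open>t + j\<close>.\<close>
  have Q: "Q (hist (t + j) \<omega>) \<longleftrightarrow> A t \<omega> = B \<and> (\<forall>s\<in>{t..<t + j}. miss U W (\<lambda>s. A s \<omega>) s)" for \<omega>
    using t by (auto simp: Q_def hist_def miss_def)
  have U: "U (hist (t + j) \<omega> (t + j)) \<longleftrightarrow> U (A (t + j) \<omega>)" for \<omega>
    using t by (simp add: hist_def)
  have eq: "{\<omega> \<in> space M. A t \<omega> = B \<and> (\<forall>s\<in>{t..<t + Suc j}. miss U W (\<lambda>s. A s \<omega>) s)} =
      {\<omega> \<in> space M. (Q (hist (t + j) \<omega>) \<and> U (hist (t + j) \<omega> (t + j))) \<and> miss U W (\<lambda>s. A s \<omega>) (t + j)}"
    unfolding Q U by (auto simp: miss_def less_Suc_eq)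
  \<comment> \<open>A miss at \<open>t + j\<close> includes \<open>U\<close>, so \<open>U\<close>
    may join the past event, as the one-step bound requires; it is dropped again in the next
    estimate.\<close>
  have "measure M {\<omega> \<in> space M. (Q (hist (t + j) \<omega>) \<and> U (hist (t + j) \<omega> (t + j))) \<and> miss U W (\<lambda>s. A s \<omega>) (t + j)} \<le>
      (1 - q) * measure M {\<omega> \<in> space M. Q (hist (t + j) \<omega>) \<and> U (hist (t + j) \<omega> (t + j))}"
  proof (rule prob_miss_step_le[where Q = "\<lambda>h. Q h \<and> U (h (t + j))"])
    show "1 \<le> t + j" using t by simp
    show "U (A (t + j) \<omega>)" if "Q (hist (t + j) \<omega>) \<and> U (hist (t + j) \<omega> (t + j))" for \<omega>
      using that U[of \<omega>] by blast
  qed (fact W, fact q)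
  also have "\<dots> \<le> (1 - q) * measure M {\<omega> \<in> space M. Q (hist (t + j) \<omega>)}"
  proof (rule mult_left_mono)
    show "measure M {\<omega> \<in> space M. Q (hist (t + j) \<omega>) \<and> U (hist (t + j) \<omega> (t + j))} \<le>
        measure M {\<omega> \<in> space M. Q (hist (t + j) \<omega>)}"
      by (rule finite_measure_mono[OF _ sets_hist[where Q = Q]]) blast
  qed (use q in simp)
  also have "\<dots> \<le> (1 - q) * ((1 - q) ^ j * measure M {\<omega> \<in> space M. A t \<omega> = B})"
    unfolding Q by (rule mult_left_mono[OF Suc]) (use q in simp)
  finally show ?case unfolding eq by (simp only: power_Suc mult.assoc)
qed simp

text \<open>A union bound over the points of the aggregate at time \<open>t\<close>, of which there
  are almost surely \<open>t\<close>. As this index set is random, the bound is taken separately on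
  each value of \<open>A t\<close>.\<close>

lemma prob_some_miss_block_le:
  fixes U :: "int \<Rightarrow> int set \<Rightarrow> bool" and W :: "int \<Rightarrow> int set \<Rightarrow> int set" and j :: nat
  assumes t: "t \<ge> 1"
    and W: "\<And>x B. U x B \<Longrightarrow> finite (W x B) \<and> W x B \<inter> B = {} \<and>
      q \<le> (\<Sum>z\<in>W x B. (\<Sum>a\<in>B. step_prob p z a * escape_prob p B z) / capacity p B)"
    and q: "q \<le> 1"
  defines "F \<equiv> {\<omega> \<in> space M. \<exists>x\<in>A t \<omega>. \<forall>s\<in>{t..<t + j}. miss (U x) (W x) (\<lambda>s. A s \<omega>) s}"
  shows "F \<in> sets M" and "measure M F \<le> real t * (1 - q) ^ j"
proof -
  have "F = {\<omega> \<in> space M. \<exists>x\<in>hist (t + j) \<omega> t. \<forall>s\<in>{t..<t + j}. miss (U x) (W x) (hist (t + j) \<omega>) s}"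
    using t by (auto simp: F_def hist_def miss_def)
  also have "\<dots> \<in> sets M" by (rule sets_hist)
  finally show F: "F \<in> sets M" .
  have "measure M (space M \<inter> F) \<le> real t * (1 - q) ^ j * measure M (space M)"
  proof (rule measure_le_of_countable_partition[where H = "A t" and I = "{B. finite B}"])
    fix B :: "int set" assume B: "B \<in> {B. finite B}"
    let ?P = "{\<omega> \<in> space M. A t \<omega> = B}"
    let ?m = "\<lambda>x. {\<omega> \<in> space M. A t \<omega> = B \<and> (\<forall>s\<in>{t..<t + j}. miss (U x) (W x) (\<lambda>s. A s \<omega>) s)}"
    have m: "?m x \<in> sets M" for x
    proof -
      have "?m x = {\<omega> \<in> space M. hist (t + j) \<omega> t = B \<and>
          (\<forall>s\<in>{t..<t + j}. miss (U x) (W x) (hist (t + j) \<omega>) s)}"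
        using t by (auto simp: hist_def miss_def)
      also have "\<dots> \<in> sets M" by (rule sets_hist)
      finally show ?thesis .
    qed
    have "measure M (?P \<inter> space M \<inter> F) \<le> real t * (1 - q) ^ j * measure M ?P"
    proof (cases "card B = t")
      case True
      have "?P \<inter> space M \<inter> F = (\<Union>x\<in>B. ?m x)" by (auto simp: F_def)
      also have "measure M \<dots> \<le> (\<Sum>x\<in>B. measure M (?m x))"
        using B m by (intro finite_measure_subadditive_finite) auto
      also have "\<dots> \<le> (\<Sum>x\<in>B. (1 - q) ^ j * measure M ?P)"
        by (intro sum_mono prob_miss_block_le t W q)
      finally show ?thesis using True by simp
    next
      case False
      have "AE \<omega> in M. A t \<omega> \<noteq> B"
        using AE_growing by eventually_elim (use growing_card[OF _ t] False in auto)
      then have "measure M ?P = 0" by (intro prob_eq_0[THEN iffD2] A_eq_sets t) auto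
      moreover have "measure M (?P \<inter> space M \<inter> F) \<le> measure M ?P"
        by (intro finite_measure_mono A_eq_sets t) auto
      ultimately show ?thesis by simp
    qed
    moreover have "?P \<inter> space M = ?P" by auto
    ultimately show "measure M (?P \<inter> space M \<inter> F) \<le> real t * (1 - q) ^ j * measure M (?P \<inter> space M)" by simp
  qed (use F t q A_eq_sets finite_A countable_Collect_finite in auto)
  moreover have "space M \<inter> F = F" by (auto simp: F_def)
  ultimately show "measure M F \<le> real t * (1 - q) ^ j" by (simp add: prob_space)
qed

end

section \<open>Growth of the capacity\<close>

lemma card_div_fiber_le:
  assumes "l \<ge> 1" "finite S"
  shows "card {z :: int. (z - x) div int l \<in> S} \<le> card S * l" "finite {z :: int. (z - x) div int l \<in> S}"
proof -
  have sub: "{z. (z - x) div int l \<in> S} \<subseteq> (\<Union>j\<in>S. {x + j * int l..<x + j * int l + int l})"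
  proof
    fix z assume z: "z \<in> {z. (z - x) div int l \<in> S}"
    have "0 \<le> (z - x) mod int l" "(z - x) mod int l < int l" using assms(1) by auto
    moreover have "(z - x) div int l * int l + (z - x) mod int l = z - x" by (rule div_mult_mod_eq)
    ultimately have "x + (z - x) div int l * int l \<le> z" "z < x + (z - x) div int l * int l + int l"
      by linarith+
    then show "z \<in> (\<Union>j\<in>S. {x + j * int l..<x + j * int l + int l})" using z by (intro UN_I) auto
  qed
  then show "finite {z. (z - x) div int l \<in> S}" 
    by (rule finite_subset) (use assms(2) in auto)
  have "card {z. (z - x) div int l \<in> S} \<le> card (\<Union>j\<in>S. {x + j * int l..<x + j * int l + int l})"
    using assms(2) by (intro card_mono sub) auto
  also have "\<dots> \<le> (\<Sum>j\<in>S. card {x + j * int l..<x + j * int l + int l})"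
    using assms(2) by (rule card_UN_le)
  finally show "card {z. (z - x) div int l \<in> S} \<le> card S * l" by simp
qed

context stable_walk
begin

text \<open>Lack of density makes escape likely, the occupied cells cover less than half of the
  window, and at least \<open>c' * l powr (1/3)\<close> points lie near \<open>x\<close>. These are
  the ingredients of \<open>sum_attachment_ge\<close>; dividing by the capacity, at most
  \<open>P\<close>, gives the rate.\<close>

lemma starved_attachment_ge:
  obtains c where "c > 0" "c \<le> 1"
    "\<And>c' P l m x B. 0 < c' \<Longrightarrow> c' \<le> c \<Longrightarrow> l \<ge> 1 \<Longrightarrow> m \<ge> 1 \<Longrightarrow> starved (capacity p) P c' l m x B \<Longrightarrow>
      finite (free_sites l m x B) \<and> free_sites l m x B \<inter> B = {} \<and>
      c0 / 16 * c' / (real m * P) \<le>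
        (\<Sum>z\<in>free_sites l m x B. (\<Sum>a\<in>B. step_prob p z a * escape_prob p B z) / capacity p B)"
proof -
  obtain c where "c > 0" "c \<le> 1" and c:
    "\<And>A x (L :: nat). finite A \<Longrightarrow> L \<ge> 1 \<Longrightarrow>
      (\<And>v :: nat. v \<ge> L \<Longrightarrow> real (card (A \<inter> {x - int v..x + int v})) \<le> c * real v powr (1/3)) \<Longrightarrow>
      3/4 * real L \<le> (\<Sum>y\<in>{x..<x + int L}. escape_prob p A y)"
    using sum_escape_prob_sparse by blast
  have "finite (free_sites l m x B) \<and> free_sites l m x B \<inter> B = {} \<and>
      c0 / 16 * c' / (real m * P) \<le>
        (\<Sum>z\<in>free_sites l m x B. (\<Sum>a\<in>B. step_prob p z a * escape_prob p B z) / capacity p B)"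
    if c': "0 < c'" "c' \<le> c" and lm: "l \<ge> 1" "m \<ge> 1" and st: "starved (capacity p) P c' l m x B"
    for c' P l m x B
  proof (intro conjI)
    define L where "L = m * l"
    let ?I = "{x..<x + int L}" and ?W = "free_sites l m x B" and ?occ = "occupied_cells l L B x"
    have L: "L \<ge> 1" using lm by (simp add: L_def Suc_le_eq)
    have B: "finite B" and P: "capacity p B \<le> P" and nd: "\<not> dense_around (c' / 24) L B x"
      and near: "c' * real l powr (1/3) \<le> real (card (B \<inter> {x - int L..x + int L}))"
      and occ: "2 * card ?occ < m"
      using st by (auto simp: starved_def L_def)
    have W: "?W \<subseteq> ?I - B" by (auto simp: free_sites_def occupied_cells_def L_def)
    then show "finite ?W" "?W \<inter> B = {}" by (auto intro: finite_subset)
    have "0 < c' * real l powr (1/3)" using c' lm by simp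
    then have "B \<noteq> {}" using near by auto
    then have cap: "capacity p B > 0" by (rule capacity_pos[OF B])
    have esc: "3/4 * real L \<le> (\<Sum>y\<in>?I. escape_prob p B y)"
    proof (rule c[OF B L])
      fix v assume "v \<ge> L"
      then have "\<not> c' / 24 * real v powr (1/3) \<le> real (card (B \<inter> {x - int v..x + int v}))"
        using nd unfolding dense_around_def by blast
      then have "real (card (B \<inter> {x - int v..x + int v})) \<le> c' / 24 * real v powr (1/3)" by linarith
      also have "\<dots> \<le> c * real v powr (1/3)" using c' by (intro mult_right_mono) auto
      finally show "real (card (B \<inter> {x - int v..x + int v})) \<le> c * real v powr (1/3)" .
    qed
    have "?I - ?W \<subseteq> {z. (z - x) div int l \<in> ?occ}" by (auto simp: free_sites_def L_def)
    then have "card (?I - ?W) \<le> card {z. (z - x) div int l \<in> ?occ}"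
      by (rule card_mono[rotated]) (intro card_div_fiber_le(2) lm finite_occupied_cells B)
    also have "\<dots> \<le> card ?occ * l"
      by (intro card_div_fiber_le(1) lm finite_occupied_cells B)
    finally have "card (?I - ?W) \<le> card ?occ * l" .
    moreover have "2 * (card ?occ * l) \<le> L"
      using mult_le_mono1[OF less_imp_le[OF occ], of l] by (simp add: L_def)
    ultimately have "2 * card (?I - ?W) \<le> L" by linarith
    then have "c0 / 16 * real (card (B \<inter> {x - int L..x + int L})) * real L powr (- \<alpha>) \<le>
        (\<Sum>z\<in>?W. \<Sum>a\<in>B. step_prob p z a * escape_prob p B z)"
      by (intro sum_attachment_ge B L esc W)
    moreover have "c0 / 16 * (c' / real m) \<le> c0 / 16 * real (card (B \<inter> {x - int L..x + int L})) * real L powr (- \<alpha>)"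
    proof -
      \<comment> \<open>The decisive use of \<alpha> < 1/3: the factor \<open>l powr (1/3)\<close>
        from nearby points compensates \<open>l powr (- \<alpha>)\<close>, and the remaining
        \<open>m powr (- \<alpha>)\<close> is at least \<open>1 / m\<close>.\<close>
      have "c' / real m \<le> c' * (real l powr (1/3) * real L powr (- \<alpha>))"
      proof -
        have "1 / real m = real m powr (- 1)" using lm by (simp add: powr_minus_divide)
        also have "\<dots> \<le> real m powr (- \<alpha>)" using alpha lm by (intro powr_mono) auto
        also have "\<dots> = 1 * real m powr (- \<alpha>)" by simp
        also have "\<dots> \<le> real l powr (1/3 - \<alpha>) * real m powr (- \<alpha>)"
          using alpha lm by (intro mult_right_mono ge_one_powr_ge_zero) auto
        also have "\<dots> = real l powr (1/3) * real L powr (- \<alpha>)"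
          using powr_add[of "real l" "1/3" "- \<alpha>"] by (simp add: L_def powr_mult)
        finally have "1 / real m \<le> real l powr (1/3) * real L powr (- \<alpha>)" .
        from mult_left_mono[OF this, of c'] c' show ?thesis by simp
      qed
      also have "\<dots> \<le> real (card (B \<inter> {x - int L..x + int L})) * real L powr (- \<alpha>)"
        using mult_right_mono[OF near, of "real L powr (- \<alpha>)"] by (simp add: mult_ac)
      finally have "c' / real m \<le> real (card (B \<inter> {x - int L..x + int L})) * real L powr (- \<alpha>)" .
      from mult_left_mono[OF this, of "c0 / 16"] c0 show ?thesis by (simp only: mult.assoc)
    qed
    ultimately have le: "c0 / 16 * (c' / real m) \<le> (\<Sum>z\<in>?W. \<Sum>a\<in>B. step_prob p z a * escape_prob p B z)"
      by linarith
    have "c0 / 16 * c' / (real m * P) = c0 / 16 * (c' / real m) / P" by simp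
    also have "\<dots> \<le> c0 / 16 * (c' / real m) / capacity p B"
      using c0 c' cap P lm by (intro divide_left_mono) auto
    also have "\<dots> \<le> (\<Sum>z\<in>?W. \<Sum>a\<in>B. step_prob p z a * escape_prob p B z) / capacity p B"
      using le cap by (intro divide_right_mono) auto
    finally show "c0 / 16 * c' / (real m * P) \<le>
        (\<Sum>z\<in>?W. (\<Sum>a\<in>B. step_prob p z a * escape_prob p B z) / capacity p B)"
      by (simp add: sum_divide_distrib)
  qed
  with \<open>c > 0\<close> \<open>c \<le> 1\<close> show thesis by (rule that)
qed

end

section \<open>From good blocks to the capacity exponent\<close>

context dla_walk
begin

text \<open>If the capacity at time \<open>n\<close> were at most \<open>P\<close>, monotonicity
  would give the same bound at all earlier times. The aggregate would then become dense around the
  origin from scale \<open>m ^ J\<close> on, with more than \<open>n\<close> points.\<close>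

lemma capacity_lower_bound_deterministic:
  fixes B :: "nat \<Rightarrow> int set"
  assumes B: "growing B" and m: "m \<ge> 1" and c: "c > 0" "c \<le> 1"
    and landing: "\<And>k t x. k < J \<Longrightarrow> 1 \<le> t \<Longrightarrow> t \<le> n \<Longrightarrow> x \<in> B t \<Longrightarrow>
      \<not> (\<forall>s\<in>{t..<t + \<tau>}. miss (starved (capacity p) P (c / 24 ^ k) (m ^ k) m x) (free_sites (m ^ k) m x) B s)"
    and time: "1 + 2 ^ J * (m * \<tau>) \<le> n" and big: "real n < c / 24 ^ J * real (m ^ J) powr (1/3)"
  shows "P < capacity p (B n)"
proof (rule ccontr)
  assume "\<not> P < capacity p (B n)"
  have n: "1 \<le> n" by (rule order_trans[OF _ time]) (rule le_add1)
  have P: "capacity p (B s) \<le> P" if "1 \<le> s" "s \<le> n" for s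
  proof -
    have "finite (B n)" using growing_card[OF B n] by blast
    then have "capacity p (B s) \<le> capacity p (B n)"
      by (rule capacity_mono) (rule growing_mono[OF B that])
    then show ?thesis using \<open>\<not> P < capacity p (B n)\<close> by linarith
  qed
  have T: "1 + delay m \<tau> J \<le> n" 
    by (rule order_trans[OF _ time], rule add_left_mono) (rule order_trans[OF le_add2 delay_le])
  have "dense_around (c / 24 ^ J) (m ^ J) (B (1 + delay m \<tau> J)) 0"
  proof (rule growth_of_dense_scale[where cap = "capacity p" and P = P and n = n and J = J and c = c])
    show "\<exists>s\<in>{t..<t + \<tau>}. starved (capacity p) P (c / 24 ^ k) (m ^ k) m x (B s) \<longrightarrow>
         (\<exists>z\<in>free_sites (m ^ k) m x (B s). B (Suc s) = B s \<union> {z})"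
      if "k < J" "1 \<le> t" "t + \<tau> \<le> n" "x \<in> B t" for k t x
    proof -
      have "t \<le> n" using that(3) by simp
      from landing[OF that(1,2) this that(4)] show ?thesis unfolding miss_def by blast
    qed
    show "0 \<in> B 1" using B by (simp add: growing_def)
    show "finite (B s)" if "1 \<le> s" for s using growing_card[OF B that] by blast
    show "B s \<subseteq> B t" if "1 \<le> s" "s \<le> t" for s t by (rule growing_mono[OF B that])
    show "1 + delay m \<tau> J \<le> n" by (rule T)
  qed (use m c P in auto)
  then obtain v where v: "v \<ge> m ^ J"
    "c / 24 ^ J * real v powr (1/3) \<le> real (card (B (1 + delay m \<tau> J) \<inter> {0 - int v..0 + int v}))"
    unfolding dense_around_def by blast
  have "c / 24 ^ J * real (m ^ J) powr (1/3) \<le> c / 24 ^ J * real v powr (1/3)"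
  proof (rule mult_left_mono)
    have "real (m ^ J) \<le> real v" using v(1) by (simp only: of_nat_le_iff)
    then show "real (m ^ J) powr (1/3) \<le> real v powr (1/3)" by (intro powr_mono2) auto
  qed (use c in simp)
  moreover have "card (B (1 + delay m \<tau> J) \<inter> {0 - int v..0 + int v}) \<le> n"
  proof -
    have fin: "finite (B (1 + delay m \<tau> J))" and card: "card (B (1 + delay m \<tau> J)) = 1 + delay m \<tau> J"
      using growing_card[OF B, of "1 + delay m \<tau> J"] by simp_all
    have "card (B (1 + delay m \<tau> J) \<inter> {0 - int v..0 + int v}) \<le> card (B (1 + delay m \<tau> J))"
      by (rule card_mono[OF fin]) blast
    then show ?thesis using card T by linarith
  qed
  ultimately show False using big v(2) by linarith
qed

text \<open>The bad event \<open>G n\<close> is that, at some scale and some starting time, a whole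
  block is missed around some point. Its probability is summable in \<open>n\<close>, so
  Borel-Cantelli leaves the deterministic bound for all large \<open>n\<close>.\<close>

lemma AE_capacity_ge:
  assumes \<epsilon>: "0 < \<epsilon>" "\<epsilon> < 1"
  shows "AE \<omega> in M. eventually (\<lambda>n. real n powr (1 - \<epsilon>) < capacity p (A n \<omega>)) sequentially"
proof -
  obtain c where c: "c > 0" "c \<le> 1" and hit:
    "\<And>c' P l m x B. 0 < c' \<Longrightarrow> c' \<le> c \<Longrightarrow> l \<ge> 1 \<Longrightarrow> m \<ge> 1 \<Longrightarrow> starved (capacity p) P c' l m x B \<Longrightarrow>
      finite (free_sites l m x B) \<and> free_sites l m x B \<inter> B = {} \<and>
      c0 / 16 * c' / (real m * P) \<le>
        (\<Sum>z\<in>free_sites l m x B. (\<Sum>a\<in>B. step_prob p z a * escape_prob p B z) / capacity p B)"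
    using starved_attachment_ge by blast
  \<comment> \<open>In powers of \<open>n\<close>, \<open>m\<close> is of order \<delta>,
    \<open>q\<close> of order 3 \<delta> - 1 and \<open>\<tau>\<close> of order 1 - 2 \<delta>. So
    \<open>\<tau> * q\<close> has order \<delta> and missed blocks are very unlikely, while the
    total delay, of order 1 - \<delta>, is small compared with \<open>n\<close>.\<close>
  define \<delta> where "\<delta> = \<epsilon> / 4"
  have \<delta>: "0 < \<delta>" "\<delta> < 1" using \<epsilon> by (auto simp: \<delta>_def)
  \<comment> \<open>Makes \<open>m ^ J\<close> at least \<open>n ^ 6\<close>, so that density from
    this scale on demands a number of points of order at least \<open>n ^ 2\<close>.\<close>
  define J where "J = nat \<lceil>6 / \<delta>\<rceil>"
  define m where "m = (\<lambda>n. nat \<lceil>real n powr \<delta>\<rceil>)"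
  define P where "P = (\<lambda>n. real n powr (1 - 4 * \<delta>))"
  define \<tau> where "\<tau> = (\<lambda>n. nat \<lfloor>real n powr (1 - 2 * \<delta>)\<rfloor>)"
  \<comment> \<open>\<open>c / 24 ^ J\<close> is below the density constants of all scales in use,
    so one rate serves all of them.\<close>
  define \<kappa> where "\<kappa> = c0 / 16 * (c / 24 ^ J)"
  define q where "q = (\<lambda>n. \<kappa> / (real (m n) * P n))"
  let ?U = "\<lambda>n k x. starved (capacity p) (P n) (c / 24 ^ k) (m n ^ k) (m n) x"
  let ?W = "\<lambda>n k x. free_sites (m n ^ k) (m n) x"
  define F where "F = (\<lambda>n k t. {\<omega> \<in> space M. \<exists>x\<in>A t \<omega>. \<forall>s\<in>{t..<t + \<tau> n}. miss (?U n k x) (?W n k x) (\<lambda>s. A s \<omega>) s})"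
  define G where "G = (\<lambda>n. \<Union>(k, t)\<in>{..<J} \<times> {1..n}. F n k t)"

  have "\<kappa> > 0" using c0 c by (simp add: \<kappa>_def)
  have "c0 \<le> 1" using pmf_ge[of 1] pmf_le_1[of p 1] by simp
  then have "\<kappa> \<le> 1"
    using c c0 mult_mono[of "c0 / 16" 1 "c / 24 ^ J" 1] by (simp add: \<kappa>_def divide_le_eq_1 le_divide_eq order_trans[OF \<open>c \<le> 1\<close>])
  have npowr: "real n powr a \<ge> 1" if "n \<ge> 1" "a \<ge> 0" for n a
    using that by (intro ge_one_powr_ge_zero) auto
  have m_ge: "real n powr \<delta> \<le> real (m n)" for n by (simp add: m_def)
  have m_le: "real (m n) \<le> 2 * real n powr \<delta>" if "n \<ge> 1" for n
    using npowr[OF that, of \<delta>] \<delta> by (simp add: m_def) linarith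
  have m1: "m n \<ge> 1" if "n \<ge> 1" for n
    using npowr[OF that, of \<delta>] \<delta> m_ge[of n] by linarith
  have P1: "P n \<ge> 1" if "n \<ge> 1" for n
    using npowr[OF that] \<epsilon> by (simp add: P_def \<delta>_def)
  have \<tau>_le: "real (\<tau> n) \<le> real n powr (1 - 2 * \<delta>)" for n by (simp add: \<tau>_def)
  have \<tau>_ge: "real n powr (1 - 2 * \<delta>) / 2 \<le> real (\<tau> n)" if "n \<ge> 1" for n
  proof -
    have "1 \<le> real n powr (1 - 2 * \<delta>)" using \<epsilon> by (intro npowr that) (simp add: \<delta>_def)
    then have "1 \<le> \<tau> n" "real n powr (1 - 2 * \<delta>) < real (\<tau> n) + 1"
      by (simp_all add: \<tau>_def le_nat_iff le_floor_iff)
    then show ?thesis by linarith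
  qed
  have q: "0 \<le> q n" "q n \<le> 1" if "n \<ge> 1" for n
  proof -
    have "1 * 1 \<le> real (m n) * P n" using m1[OF that] P1[OF that] by (intro mult_mono) auto
    then show "0 \<le> q n" "q n \<le> 1" using \<open>\<kappa> > 0\<close> \<open>\<kappa> \<le> 1\<close> by (auto simp: q_def divide_le_eq)
  qed

  have F: "F n k t \<in> sets M" "measure M (F n k t) \<le> real n * (1 - q n) ^ \<tau> n"
    if "k < J" "1 \<le> t" "t \<le> n" for n k t
  proof -
    have n: "n \<ge> 1" using that by simp
    have W: "finite (?W n k x B) \<and> ?W n k x B \<inter> B = {} \<and>
        q n \<le> (\<Sum>z\<in>?W n k x B. (\<Sum>a\<in>B. step_prob p z a * escape_prob p B z) / capacity p B)"
      if "?U n k x B" for x B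
    proof -
      have "c / 24 ^ J \<le> c / 24 ^ k"
        using c \<open>k < J\<close> by (intro divide_left_mono power_increasing) auto
      then have "q n \<le> c0 / 16 * (c / 24 ^ k) / (real (m n) * P n)"
        unfolding q_def \<kappa>_def using c0 P1[OF n] by (intro divide_right_mono mult_left_mono) auto
      moreover have "c / 24 ^ k \<le> c" using c by (simp add: divide_le_eq)
      ultimately show ?thesis
        using hit[OF _ _ _ m1[OF n] that] c m1[OF n] by force
    qed
    have *: "F n k t \<in> sets M" "measure M (F n k t) \<le> real t * (1 - q n) ^ \<tau> n"
      unfolding F_def
      using prob_some_miss_block_le[where U = "?U n k" and W = "?W n k" and j = "\<tau> n", OF \<open>1 \<le> t\<close> W q(2)[OF n]]
      by auto
    show "F n k t \<in> sets M" by (rule *)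
    have "real t * (1 - q n) ^ \<tau> n \<le> real n * (1 - q n) ^ \<tau> n"
      using q[OF n] that by (intro mult_right_mono) auto
    then show "measure M (F n k t) \<le> real n * (1 - q n) ^ \<tau> n" using *(2) by linarith
  qed
  have G_sets: "G n \<in> sets M" for n
    unfolding G_def by (intro sets.finite_UN) (auto intro!: F(1))
  have G_le: "measure M (G n) \<le> real J * (real n ^ 2 * exp (- (\<kappa> / 4 * real n powr \<delta>)))" if n: "n \<ge> 1" for n
  proof -
    have "measure M (G n) \<le> (\<Sum>(k, t)\<in>{..<J} \<times> {1..n}. measure M (F n k t))"
      unfolding G_def case_prod_unfold by (intro finite_measure_subadditive_finite) (auto intro!: F(1))
    also have "\<dots> \<le> (\<Sum>(k, t)\<in>{..<J} \<times> {1..n}. real n * (1 - q n) ^ \<tau> n)"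
      unfolding case_prod_unfold by (intro sum_mono F(2)) auto
    also have "\<dots> = real J * (real n ^ 2 * (1 - q n) ^ \<tau> n)"
      by (simp add: case_prod_unfold power2_eq_square mult_ac)
    also have "(1 - q n) ^ \<tau> n \<le> exp (- (\<kappa> / 4 * real n powr \<delta>))"
    proof -
      \<comment> \<open>The factor 1/4 pays for the rounding of \<open>\<tau> n\<close> and of
        \<open>m n\<close>, a factor 2 each.\<close>
      have exponent: "\<kappa> / 4 * real n powr \<delta> \<le> real (\<tau> n) * q n"
      proof -
        have "\<kappa> / 4 * real n powr \<delta> =
            real n powr (1 - 2 * \<delta>) / 2 * (\<kappa> / (2 * real n powr \<delta> * real n powr (1 - 4 * \<delta>)))"
        proof -
          have "real n powr (1 - 2 * \<delta>) = real n powr \<delta> * (real n powr \<delta> * real n powr (1 - 4 * \<delta>))"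
            by (simp flip: powr_add)
          then show ?thesis using n by simp
        qed
        also have "\<dots> \<le> real (\<tau> n) * (\<kappa> / (real (m n) * P n))"
          unfolding P_def using \<tau>_ge[OF n] m_le[OF n] m1[OF n] \<open>\<kappa> > 0\<close> n
          by (intro mult_mono divide_left_mono mult_right_mono) auto
        finally show ?thesis by (simp add: q_def)
      qed
      have "(1 - q n) ^ \<tau> n \<le> exp (- q n) ^ \<tau> n"
        using q[OF n] exp_ge_add_one_self[of "- q n"] by (intro power_mono) auto
      also have "\<dots> = exp (- (real (\<tau> n) * q n))" by (simp add: exp_of_nat_mult[symmetric])
      also have "\<dots> \<le> exp (- (\<kappa> / 4 * real n powr \<delta>))" using exponent by simp
      finally show ?thesis .
    qed
    finally show ?thesis by (simp add: mult_left_mono)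
  qed
  \<comment> \<open>The power 4 absorbs the factor \<open>n ^ 2\<close> of the union bound and
    leaves the summable \<open>1 / n ^ 2\<close>.\<close>
  have "(\<lambda>n. real n ^ 4 * exp (- (\<kappa> / 4 * real n powr \<delta>))) \<longlonglongrightarrow> 0"
    using \<open>\<kappa> > 0\<close> \<delta> by real_asymp
  then have "Bseq (\<lambda>n. real n ^ 4 * exp (- (\<kappa> / 4 * real n powr \<delta>)))"
    by (intro convergent_imp_Bseq) (auto simp: convergent_def)
  then obtain E where E: "\<And>n. real n ^ 4 * exp (- (\<kappa> / 4 * real n powr \<delta>)) \<le> E"
    by (auto simp: Bseq_def)
  have "summable (\<lambda>n. measure M (G n))"
  proof (rule summable_comparison_test_ev)
    show "eventually (\<lambda>n. norm (measure M (G n)) \<le> real J * E * inverse (real n ^ 2)) sequentially"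
      using eventually_ge_at_top[of 1]
    proof eventually_elim
      case (elim n)
      have "real n ^ 2 * exp (- (\<kappa> / 4 * real n powr \<delta>)) \<le> E * inverse (real n ^ 2)"
        using E[of n] elim by (simp add: field_simps flip: power_add)
      then have "real J * (real n ^ 2 * exp (- (\<kappa> / 4 * real n powr \<delta>))) \<le> real J * (E * inverse (real n ^ 2))"
        by (rule mult_left_mono) simp
      then show ?case using G_le[OF elim] by (simp add: mult.assoc)
    qed
    show "summable (\<lambda>n. real J * E * inverse (real n ^ 2))"
      by (intro summable_mult inverse_power_summable) simp
  qed
  then have avoid: "AE \<omega> in M. eventually (\<lambda>n. \<omega> \<in> space M - G n) sequentially"
    using G_sets by (intro borel_cantelli_AE1) (auto simp: emeasure_eq_measure)
  have big: "eventually (\<lambda>n. real n < c / 24 ^ J * real n ^ 2) sequentially"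
    using c by real_asymp
  have time: "eventually (\<lambda>n. 1 + 2 ^ J * (2 * real n powr (1 - \<delta>)) \<le> real n) sequentially"
    using \<delta> by real_asymp
  show ?thesis
    using avoid AE_growing
  proof eventually_elim
    case (elim \<omega>)
    show ?case
      using elim(1) big time eventually_ge_at_top[of 1]
    proof eventually_elim
      case (elim n)
      note n = \<open>1 \<le> n\<close>
      have "P n < capacity p (A n \<omega>)"
      proof (rule capacity_lower_bound_deterministic[OF \<open>growing (\<lambda>n. A n \<omega>)\<close> m1[OF n] c])
        show "\<not> (\<forall>s\<in>{t..<t + \<tau> n}. miss (?U n k x) (?W n k x) (\<lambda>n. A n \<omega>) s)"
          if "k < J" "1 \<le> t" "t \<le> n" "x \<in> A t \<omega>" for k t x
          using elim(1) that unfolding G_def F_def by force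
        have "real (m n) * real (\<tau> n) \<le> (2 * real n powr \<delta>) * real n powr (1 - 2 * \<delta>)"
          by (intro mult_mono m_le[OF n] \<tau>_le) auto
        also have "\<dots> = 2 * real n powr (1 - \<delta>)" by (simp add: powr_add[symmetric])
        finally have "2 ^ J * (real (m n) * real (\<tau> n)) \<le> 2 ^ J * (2 * real n powr (1 - \<delta>))"
          by (rule mult_left_mono) simp
        then have "1 + 2 ^ J * (real (m n) * real (\<tau> n)) \<le> real n" using elim(3) by linarith
        then have "real (1 + 2 ^ J * (m n * \<tau> n)) \<le> real n" by simp
        then show "1 + 2 ^ J * (m n * \<tau> n) \<le> n" by (simp only: of_nat_le_iff)
        have "real n ^ 2 = real n powr 2" using n by simp
        also have "\<dots> = (real n powr 6) powr (1/3)" by (simp only: powr_powr) simp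
        also have "\<dots> \<le> real (m n ^ J) powr (1/3)"
        proof (rule powr_mono2)
          have "6 / \<delta> \<le> real J" unfolding J_def by (rule real_nat_ceiling_ge)
          then have "6 \<le> \<delta> * real J" using \<delta> by (simp add: field_simps)
          then have "real n powr 6 \<le> real n powr (\<delta> * real J)" using n by (intro powr_mono) auto
          also have "\<dots> = (real n powr \<delta>) ^ J" using n by (simp add: powr_powr[symmetric] powr_realpow)
          also have "\<dots> \<le> real (m n) ^ J" by (intro power_mono m_ge) auto
          finally show "real n powr 6 \<le> real (m n ^ J)" by simp
        qed auto
        finally have "c / 24 ^ J * real n ^ 2 \<le> c / 24 ^ J * real (m n ^ J) powr (1/3)"
          using c by (intro mult_left_mono) auto
        then show "real n < c / 24 ^ J * real (m n ^ J) powr (1/3)" using elim(2) by linarith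
      qed
      then show ?case by (simp add: P_def \<delta>_def)
    qed
  qed
qed

text \<open>For the lower bound, the exponents \<open>1 - 1 / (j + 2)\<close> form a countable
  family, so their exceptional sets have a null union. For the upper bound, the capacity is at most
  the number \<open>n\<close> of points.\<close>

lemma AE_ln_capacity: "AE \<omega> in M. (\<lambda>n. ln (capacity p (A n \<omega>)) / ln (real n)) \<longlonglongrightarrow> 1"
proof -
  have "AE \<omega> in M. \<forall>j. eventually (\<lambda>n. real n powr (1 - 1 / (real j + 2)) < capacity p (A n \<omega>)) sequentially"
    unfolding AE_all_countable by (intro allI AE_capacity_ge) auto
  then show ?thesis
    using AE_growing
  proof eventually_elim
    case (elim \<omega>)
    show ?case
    proof (rule order_tendstoI)
      fix a :: real assume "a < 1"
      then obtain j where j: "1 / (real j + 2) < 1 - a"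
      proof -
        obtain j where "inverse (real (Suc j)) < 1 - a" using \<open>a < 1\<close> reals_Archimedean[of "1 - a"] by auto
        moreover have "1 / (real j + 2) \<le> inverse (real (Suc j))" by (simp add: field_simps)
        ultimately have "1 / (real j + 2) < 1 - a" by linarith
        then show thesis by (rule that)
      qed
      show "eventually (\<lambda>n. a < ln (capacity p (A n \<omega>)) / ln (real n)) sequentially"
        using elim(1)[rule_format, of j] eventually_ge_at_top[of 2]
      proof eventually_elim
        case (elim n)
        have "ln (real n) > 0" using elim by simp
        have "ln (real n powr (1 - 1 / (real j + 2))) < ln (capacity p (A n \<omega>))"
          using elim by (subst ln_less_cancel_iff) (auto intro: less_trans[rotated])
        then have "(1 - 1 / (real j + 2)) * ln (real n) < ln (capacity p (A n \<omega>))"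
          using elim by (simp add: ln_powr)
        then have "1 - 1 / (real j + 2) < ln (capacity p (A n \<omega>)) / ln (real n)"
          using \<open>ln (real n) > 0\<close> by (simp add: less_divide_eq)
        then show ?case using j by linarith
      qed
    next
      fix a :: real assume "1 < a"
      show "eventually (\<lambda>n. ln (capacity p (A n \<omega>)) / ln (real n) < a) sequentially"
        using eventually_ge_at_top[of 2]
      proof eventually_elim
        case (elim n)
        have card: "finite (A n \<omega>)" "card (A n \<omega>) = n"
          using growing_card[OF \<open>growing (\<lambda>n. A n \<omega>)\<close>, of n] elim by auto
        then have "0 < capacity p (A n \<omega>)" using elim by (intro capacity_pos) auto
        moreover have "capacity p (A n \<omega>) \<le> real n" using capacity_le_card[of p "A n \<omega>"] card by simp
        ultimately have "ln (capacity p (A n \<omega>)) \<le> ln (real n)" by simp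
        then have "ln (capacity p (A n \<omega>)) / ln (real n) \<le> 1" using elim by (simp add: divide_le_eq_1)
        then show ?case using \<open>1 < a\<close> by linarith
      qed
    qed
  qed
qed

end

theorem theorem17:
  fixes \<alpha> c0 C0 :: real and p :: "int pmf"
    and M :: "'w measure" and A :: "nat \<Rightarrow> 'w \<Rightarrow> int set"
  assumes "0 < \<alpha>" and "\<alpha> < 1/3"
    and "symmetric_step p"
    and "0 < c0" and "c0 < C0"
    and "\<And>x. x \<noteq> 0 \<Longrightarrow> c0 * \<bar>real_of_int x\<bar> powr (- 1 - \<alpha>) \<le> step_prob p 0 x"
    and "\<And>x. x \<noteq> 0 \<Longrightarrow> step_prob p 0 x \<le> C0 * \<bar>real_of_int x\<bar> powr (- 1 - \<alpha>)"
    and "dla_process p M A"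
  shows "AE \<omega> in M. (\<lambda>n. ln (capacity p (A n \<omega>)) / ln (real n)) \<longlonglongrightarrow> 1"
proof -
  interpret dla_walk \<alpha> c0 C0 p M A
    using assms by unfold_locales (auto simp: step_prob_eq_pmf)
  show ?thesis by (rule AE_ln_capacity)
qed

end
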